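(* Let $\tau$ be a finite $\mathbb F$-stopping time and let $v$ be a làglàd process such that $(v,z)\in\mathcal O(\mathbb F)\times\mathcal P_d(\mathbb F)$ is a solution on $[\![0,\tau]\!]$ to the BSDE $$v_t=\xi_\tau-h(\tau,v_{\tau-},\xi_\tau)-\int_{]t,\tau]}f^r_s(v_{s-},v_s,z_s)\,dD^c_s-\int_{]t,\tau]}z_s\,dM_s-\sum_{t\le s<\tau}h(s,v_{s-},v_{s+}).$$ Then $(y,z)$, where $y:=v_+\mathbf 1_{[\![0,\tau]\!]}+h(\tau,v_{\tau-},\xi_\tau)\mathbf 1_{[\![\tau]\!]}$, is a solution on $[\![0,\tau]\!]$ to the càdlàg BSDE $$y_t=\xi_\tau-\int_{]t,\tau]}f^r_s(y_{s-},y_s,z_s)\,dD^c_s-\sum_{t<s\le\tau}h(s,y_{s-},y_s)-\int_{]t,\tau]}z_s\,dM_s.$$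
   Context: $\mathbb F$ is a filtration satisfying the usual conditions, $\mathcal O(\mathbb F)$ and $\mathcal P_d(\mathbb F)$ are the classes of real-valued $\mathbb F$-optional and $\mathbb R^d$-valued $\mathbb F$-predictable processes. $M$ is an $\mathbb R^d$-valued $\mathbb F$-local martingale, $D^c$ is the continuous part of a càdlàg $\mathbb F$-adapted process $D^r$ of finite variation, $\xi_\tau$ is a bounded $\mathcal F_\tau$-measurable random variable, and $f^r$ and $h$ are given mappings, where $h(s,\cdot,\cdot)=0$ outside the graphs of a finite set of $\mathbb F$-predictable stopping times $(T_i)_{i=1,\dots,p}$. Làglàd means having left and right limits; $v_+$ is the right-limit process of $v$; solutions are stopped at $\tau$, so that $v_{\tau+}=v_\tau$. In the càdlàg BSDE a solution is a pair $(y,z)\in\mathcal O(\mathbb F)\times\mathcal P_d(\mathbb F)$ with $y$ càdlàg. *)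

theory Defs
  imports "HOL-Probability.Probability"
begin

text \<open>
  A process is a function \<open>X :: real \<Rightarrow> 'a \<Rightarrow> 'b\<close>; only its values \<open>X t \<omega>\<close> with \<open>t \<ge> 0\<close> and
  \<open>\<omega> \<in> space P\<close> are relevant. Filtrations are indexed by \<open>real\<close> so that the library notions
  \<open>filtration\<close>, \<open>stopping_time\<close> and \<open>pre_sigma\<close> apply. A filtration on \<open>[0, \<infinity>)\<close> is extended by
  \<open>F t = F 0\<close> for \<open>t < 0\<close>, say; for stopping times with values in \<open>[0, \<infinity>)\<close> the negative
  indices play no role.
\<close>

definition usual_conditions :: "'a measure \<Rightarrow> (real \<Rightarrow> 'a measure) \<Rightarrow> bool" where
  "usual_conditions P F \<longleftrightarrow>
     prob_space P \<and> filtration (space P) F \<and> (\<forall>t. subalgebra P (F t)) \<and>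
     (\<forall>A\<in>null_sets P. \<forall>N. N \<subseteq> A \<longrightarrow> N \<in> sets (F 0)) \<and>
     (\<forall>t\<ge>0. sets (F t) = (\<Inter>s\<in>{t<..}. sets (F s)))"

definition finite_stopping_time :: "'a measure \<Rightarrow> (real \<Rightarrow> 'a measure) \<Rightarrow> ('a \<Rightarrow> real) \<Rightarrow> bool" where
  "finite_stopping_time P F \<tau> \<longleftrightarrow> stopping_time F \<tau> \<and> (\<forall>\<omega>\<in>space P. 0 \<le> \<tau> \<omega>)"


section \<open>Path properties\<close>

definition cadlag :: "'a measure \<Rightarrow> (real \<Rightarrow> 'a \<Rightarrow> real) \<Rightarrow> bool" where
  "cadlag P X \<longleftrightarrow> (\<forall>\<omega>\<in>space P. \<forall>t\<ge>0.
     ((\<lambda>s. X s \<omega>) \<longlongrightarrow> X t \<omega>) (at_right t) \<and>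
     (0 < t \<longrightarrow> (\<exists>l. ((\<lambda>s. X s \<omega>) \<longlongrightarrow> l) (at_left t))))"

definition laglad :: "'a measure \<Rightarrow> (real \<Rightarrow> 'a \<Rightarrow> real) \<Rightarrow> bool" where
  "laglad P X \<longleftrightarrow> (\<forall>\<omega>\<in>space P. \<forall>t\<ge>0.
     (\<exists>r. ((\<lambda>s. X s \<omega>) \<longlongrightarrow> r) (at_right t)) \<and>
     (0 < t \<longrightarrow> (\<exists>l. ((\<lambda>s. X s \<omega>) \<longlongrightarrow> l) (at_left t))))"

definition left_continuous :: "'a measure \<Rightarrow> (real \<Rightarrow> 'a \<Rightarrow> real) \<Rightarrow> bool" where
  "left_continuous P X \<longleftrightarrow> (\<forall>\<omega>\<in>space P. \<forall>t>0. ((\<lambda>s. X s \<omega>) \<longlongrightarrow> X t \<omega>) (at_left t))"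

text \<open>Convention at the origin: \<open>X\<^bsub>0-\<^esub> = X\<^sub>0\<close>.\<close>

definition left_lim :: "(real \<Rightarrow> 'a \<Rightarrow> real) \<Rightarrow> real \<Rightarrow> 'a \<Rightarrow> real" where
  "left_lim X t \<omega> = (if t \<le> 0 then X 0 \<omega> else Lim (at_left t) (\<lambda>s. X s \<omega>))"

definition right_lim :: "(real \<Rightarrow> 'a \<Rightarrow> real) \<Rightarrow> real \<Rightarrow> 'a \<Rightarrow> real" where
  "right_lim X t \<omega> = Lim (at_right t) (\<lambda>s. X s \<omega>)"

definition jump :: "(real \<Rightarrow> 'a \<Rightarrow> real) \<Rightarrow> real \<Rightarrow> 'a \<Rightarrow> real" where
  "jump X t \<omega> = X t \<omega> - left_lim X t \<omega>"

definition stopped :: "('a \<Rightarrow> real) \<Rightarrow> (real \<Rightarrow> 'a \<Rightarrow> 'b) \<Rightarrow> real \<Rightarrow> 'a \<Rightarrow> 'b" where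
  "stopped \<tau> X t \<omega> = X (min t (\<tau> \<omega>)) \<omega>"

definition finite_variation :: "'a measure \<Rightarrow> (real \<Rightarrow> 'a \<Rightarrow> real) \<Rightarrow> bool" where
  "finite_variation P X \<longleftrightarrow> (\<forall>\<omega>\<in>space P. \<forall>T\<ge>0. \<exists>K. \<forall>n. \<forall>u::nat \<Rightarrow> real.
     0 \<le> u 0 \<and> mono u \<and> u n \<le> T \<longrightarrow> (\<Sum>i<n. \<bar>X (u (Suc i)) \<omega> - X (u i) \<omega>\<bar>) \<le> K)"

text \<open>For a cadlag process of finite variation the sum of the jumps converges absolutely.\<close>

definition continuous_part :: "(real \<Rightarrow> 'a \<Rightarrow> real) \<Rightarrow> real \<Rightarrow> 'a \<Rightarrow> real" where
  "continuous_part D t \<omega> = D t \<omega> - (\<Sum>\<^sub>\<infinity>s\<in>{0<..t}. jump D s \<omega>)"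


section \<open>Measurability of processes\<close>

definition adapted :: "(real \<Rightarrow> 'a measure) \<Rightarrow> (real \<Rightarrow> 'a \<Rightarrow> real) \<Rightarrow> bool" where
  "adapted F X \<longleftrightarrow> (\<forall>t\<ge>0. X t \<in> borel_measurable (F t))"

definition optional_sigma :: "'a measure \<Rightarrow> (real \<Rightarrow> 'a measure) \<Rightarrow> (real \<times> 'a) measure" where
  "optional_sigma P F = sigma ({0..} \<times> space P)
     {{(t, \<omega>). 0 \<le> t \<and> \<omega> \<in> space P \<and> X t \<omega> \<in> B} | X B.
        adapted F X \<and> cadlag P X \<and> B \<in> sets borel}"

definition predictable_sigma :: "'a measure \<Rightarrow> (real \<Rightarrow> 'a measure) \<Rightarrow> (real \<times> 'a) measure" where
  "predictable_sigma P F = sigma ({0..} \<times> space P)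
     {{(t, \<omega>). 0 \<le> t \<and> \<omega> \<in> space P \<and> X t \<omega> \<in> B} | X B.
        adapted F X \<and> left_continuous P X \<and> B \<in> sets borel}"

definition optional_process :: "'a measure \<Rightarrow> (real \<Rightarrow> 'a measure) \<Rightarrow> (real \<Rightarrow> 'a \<Rightarrow> real) \<Rightarrow> bool" where
  "optional_process P F X \<longleftrightarrow> (\<lambda>(t, \<omega>). X t \<omega>) \<in> borel_measurable (optional_sigma P F)"

definition predictable_process ::
  "'a measure \<Rightarrow> (real \<Rightarrow> 'a measure) \<Rightarrow> (real \<Rightarrow> 'a \<Rightarrow> real^'d) \<Rightarrow> bool" where
  "predictable_process P F X \<longleftrightarrow> (\<lambda>(t, \<omega>). X t \<omega>) \<in> borel_measurable (predictable_sigma P F)"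

text \<open>Predictable times may take the value \<open>\<infinity>\<close>; predictability means that the stochastic
  interval \<open>[[0, T[[\<close> is predictable.\<close>

definition predictable_stopping_time ::
  "'a measure \<Rightarrow> (real \<Rightarrow> 'a measure) \<Rightarrow> ('a \<Rightarrow> ereal) \<Rightarrow> bool" where
  "predictable_stopping_time P F T \<longleftrightarrow>
     (\<forall>\<omega>\<in>space P. 0 \<le> T \<omega>) \<and> (\<forall>t::real. Measurable.pred (F t) (\<lambda>\<omega>. T \<omega> \<le> ereal t)) \<and>
     {(t, \<omega>). 0 \<le> t \<and> \<omega> \<in> space P \<and> ereal t < T \<omega>} \<in> sets (predictable_sigma P F)"


section \<open>Local martingales\<close>

definition martingale :: "'a measure \<Rightarrow> (real \<Rightarrow> 'a measure) \<Rightarrow> (real \<Rightarrow> 'a \<Rightarrow> real) \<Rightarrow> bool" where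
  "martingale P F X \<longleftrightarrow> adapted F X \<and> (\<forall>t\<ge>0. integrable P (X t)) \<and>
     (\<forall>s t. 0 \<le> s \<and> s \<le> t \<longrightarrow> (AE \<omega> in P. real_cond_exp P (F s) (X t) \<omega> = X s \<omega>))"

definition local_martingale :: "'a measure \<Rightarrow> (real \<Rightarrow> 'a measure) \<Rightarrow> (real \<Rightarrow> 'a \<Rightarrow> real) \<Rightarrow> bool" where
  "local_martingale P F X \<longleftrightarrow> adapted F X \<and> cadlag P X \<and>
     (\<exists>S::nat \<Rightarrow> 'a \<Rightarrow> real.
        (\<forall>n. finite_stopping_time P F (S n)) \<and>
        (\<forall>\<omega>\<in>space P. incseq (\<lambda>n. S n \<omega>)) \<and>
        (AE \<omega> in P. filterlim (\<lambda>n. S n \<omega>) at_top sequentially) \<and>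
        (\<forall>n. martingale P F (\<lambda>t \<omega>. stopped (S n) X t \<omega> - X 0 \<omega>)))"

definition local_martingale_vec ::
  "'a measure \<Rightarrow> (real \<Rightarrow> 'a measure) \<Rightarrow> (real \<Rightarrow> 'a \<Rightarrow> real^'d) \<Rightarrow> bool" where
  "local_martingale_vec P F M \<longleftrightarrow> (\<forall>i. local_martingale P F (\<lambda>t \<omega>. M t \<omega> $ i))"


section \<open>Lebesgue-Stieltjes integral\<close>

text \<open>
  Integral over \<open>S \<subseteq> (0, \<infinity>)\<close> against a right-continuous path \<open>A\<close> of finite variation on compacts,
  through a decomposition \<open>A = G - H\<close> into increasing right-continuous functions. Integrability
  for some decomposition amounts to integrability against the total variation measure (take the
  Jordan decomposition), and the value does not depend on the decomposition.
\<close>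

definition has_ls_integral ::
  "(real \<Rightarrow> real) \<Rightarrow> (real \<Rightarrow> real) \<Rightarrow> real set \<Rightarrow> real \<Rightarrow> bool" where
  "has_ls_integral f A S I \<longleftrightarrow> (\<exists>G H. mono G \<and> mono H \<and>
     (\<forall>t. continuous (at_right t) G) \<and> (\<forall>t. continuous (at_right t) H) \<and>
     (\<forall>t\<ge>0. A t = G t - H t) \<and>
     set_integrable (interval_measure G) S f \<and> set_integrable (interval_measure H) S f \<and>
     I = (LINT s:S|interval_measure G. f s) - (LINT s:S|interval_measure H. f s))"

definition ls_integrable :: "(real \<Rightarrow> real) \<Rightarrow> (real \<Rightarrow> real) \<Rightarrow> real set \<Rightarrow> bool" where
  "ls_integrable f A S \<longleftrightarrow> (\<exists>I. has_ls_integral f A S I)"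

definition ls_integral :: "(real \<Rightarrow> real) \<Rightarrow> (real \<Rightarrow> real) \<Rightarrow> real set \<Rightarrow> real" where
  "ls_integral f A S = (THE I. has_ls_integral f A S I)"


section \<open>Stochastic integral with respect to a vector local martingale\<close>

text \<open>\<open>C\<close> is (a version of) the quadratic covariation \<open>[X, Y]\<close> of the local martingales \<open>X, Y\<close>,
  with \<open>[X, Y]\<^sub>0 = 0\<close>.\<close>

definition quadratic_covariation ::
  "'a measure \<Rightarrow> (real \<Rightarrow> 'a measure) \<Rightarrow> (real \<Rightarrow> 'a \<Rightarrow> real) \<Rightarrow> (real \<Rightarrow> 'a \<Rightarrow> real) \<Rightarrow>
    (real \<Rightarrow> 'a \<Rightarrow> real) \<Rightarrow> bool" where
  "quadratic_covariation P F X Y C \<longleftrightarrow>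
     adapted F C \<and> cadlag P C \<and> finite_variation P C \<and> (\<forall>\<omega>\<in>space P. C 0 \<omega> = 0) \<and>
     (AE \<omega> in P. \<forall>t>0. jump C t \<omega> = jump X t \<omega> * jump Y t \<omega>) \<and>
     local_martingale P F (\<lambda>t \<omega>. X t \<omega> * Y t \<omega> - C t \<omega>)"

definition bounded_martingale :: "'a measure \<Rightarrow> (real \<Rightarrow> 'a measure) \<Rightarrow> (real \<Rightarrow> 'a \<Rightarrow> real) \<Rightarrow> bool" where
  "bounded_martingale P F B \<longleftrightarrow> martingale P F B \<and> cadlag P B \<and>
     (\<exists>b. \<forall>t\<ge>0. \<forall>\<omega>\<in>space P. \<bar>B t \<omega>\<bar> \<le> b)"

text \<open>
  \<open>N\<close> is a version of \<open>\<integral> z dM\<close>: the local martingale null at \<open>0\<close> determined by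
  \<open>[N, B] = z \<sqdot> [M, B]\<close> for all bounded martingales \<open>B\<close>. In the vector integral the components
  \<open>z\<^sub>i\<close> need not be integrable separately against \<open>[M\<^sub>i, B]\<close>, whence the identity is imposed on
  the predictable sets \<open>{\<bar>z\<bar> \<le> n}\<close>, which exhaust \<open>[0, \<infinity>) \<times> \<Omega>\<close> and on which all integrands are
  bounded. Such an \<open>N\<close> exists iff \<open>(\<integral> z\<^sup>T d[M] z)\<^bsup>1/2\<^esup>\<close> is locally integrable, and is unique up to
  indistinguishability.
\<close>

definition has_stoch_integral ::
  "'a measure \<Rightarrow> (real \<Rightarrow> 'a measure) \<Rightarrow> (real \<Rightarrow> 'a \<Rightarrow> real^'d) \<Rightarrow> (real \<Rightarrow> 'a \<Rightarrow> real^'d) \<Rightarrow>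
    (real \<Rightarrow> 'a \<Rightarrow> real) \<Rightarrow> bool" where
  "has_stoch_integral P F z M N \<longleftrightarrow>
     predictable_process P F z \<and> local_martingale P F N \<and> (\<forall>\<omega>\<in>space P. N 0 \<omega> = 0) \<and>
     (\<forall>B. bounded_martingale P F B \<longrightarrow> (\<exists>K C.
        quadratic_covariation P F N B K \<and>
        (\<forall>i. quadratic_covariation P F (\<lambda>t \<omega>. M t \<omega> $ i) B (C i)) \<and>
        (\<forall>n::nat. AE \<omega> in P. \<forall>t\<ge>0.
           ls_integral (\<lambda>s. if norm (z s \<omega>) \<le> real n then 1 else 0) (\<lambda>s. K s \<omega>) {0<..t} =
           (\<Sum>i\<in>UNIV. ls_integral (\<lambda>s. if norm (z s \<omega>) \<le> real n then z s \<omega> $ i else 0)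
              (\<lambda>s. C i s \<omega>) {0<..t}))))"

definition stoch_integrable ::
  "'a measure \<Rightarrow> (real \<Rightarrow> 'a measure) \<Rightarrow> (real \<Rightarrow> 'a \<Rightarrow> real^'d) \<Rightarrow> (real \<Rightarrow> 'a \<Rightarrow> real^'d) \<Rightarrow> bool" where
  "stoch_integrable P F z M \<longleftrightarrow> (\<exists>N. has_stoch_integral P F z M N)"

definition stoch_integral ::
  "'a measure \<Rightarrow> (real \<Rightarrow> 'a measure) \<Rightarrow> (real \<Rightarrow> 'a \<Rightarrow> real^'d) \<Rightarrow> (real \<Rightarrow> 'a \<Rightarrow> real^'d) \<Rightarrow>
    real \<Rightarrow> 'a \<Rightarrow> real" where
  "stoch_integral P F z M = (SOME N. has_stoch_integral P F z M N)"

text \<open>\<open>z\<close> restricted to \<open>[[0, \<tau>]]\<close>, so that integrability of \<open>z\<close> is only required there.\<close>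

definition restrict_to :: "('a \<Rightarrow> real) \<Rightarrow> (real \<Rightarrow> 'a \<Rightarrow> real^'d) \<Rightarrow> real \<Rightarrow> 'a \<Rightarrow> real^'d" where
  "restrict_to \<tau> z t \<omega> = (if t \<le> \<tau> \<omega> then z t \<omega> else 0)"

definition stoch_integral_upto ::
  "'a measure \<Rightarrow> (real \<Rightarrow> 'a measure) \<Rightarrow> ('a \<Rightarrow> real) \<Rightarrow> (real \<Rightarrow> 'a \<Rightarrow> real^'d) \<Rightarrow>
    (real \<Rightarrow> 'a \<Rightarrow> real^'d) \<Rightarrow> real \<Rightarrow> 'a \<Rightarrow> real" where
  "stoch_integral_upto P F \<tau> z M t \<omega> =
     stoch_integral P F (restrict_to \<tau> z) M (\<tau> \<omega>) \<omega> - stoch_integral P F (restrict_to \<tau> z) M t \<omega>"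


section \<open>The two equations\<close>

text \<open>
  Solutions on \<open>[[0, \<tau>]]\<close> are stopped at \<open>\<tau>\<close>, so a process given on \<open>[[0, \<tau>]]\<close> is identified with
  its extension by the value at \<open>\<tau>\<close>. The equations hold for all \<open>t \<in> [0, \<tau>]\<close> outside a null set.
\<close>

definition stopped_at :: "'a measure \<Rightarrow> ('a \<Rightarrow> real) \<Rightarrow> (real \<Rightarrow> 'a \<Rightarrow> real) \<Rightarrow> bool" where
  "stopped_at P \<tau> X \<longleftrightarrow> (\<forall>\<omega>\<in>space P. \<forall>t\<ge>0. X t \<omega> = stopped \<tau> X t \<omega>)"

definition laglad_bsde_solution ::
  "'a measure \<Rightarrow> (real \<Rightarrow> 'a measure) \<Rightarrow> ('a \<Rightarrow> real) \<Rightarrow> ('a \<Rightarrow> real) \<Rightarrow>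
    (real \<Rightarrow> 'a \<Rightarrow> real \<Rightarrow> real \<Rightarrow> real^'d \<Rightarrow> real) \<Rightarrow> (real \<Rightarrow> 'a \<Rightarrow> real \<Rightarrow> real \<Rightarrow> real) \<Rightarrow>
    (real \<Rightarrow> 'a \<Rightarrow> real) \<Rightarrow> (real \<Rightarrow> 'a \<Rightarrow> real^'d) \<Rightarrow>
    (real \<Rightarrow> 'a \<Rightarrow> real) \<Rightarrow> (real \<Rightarrow> 'a \<Rightarrow> real^'d) \<Rightarrow> bool" where
  "laglad_bsde_solution P F \<tau> \<xi> f h D M v z \<longleftrightarrow>
     optional_process P F v \<and> predictable_process P F z \<and> laglad P v \<and> stopped_at P \<tau> v \<and>
     stoch_integrable P F (restrict_to \<tau> z) M \<and>
     (AE \<omega> in P.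
        ls_integrable (\<lambda>s. f s \<omega> (left_lim v s \<omega>) (v s \<omega>) (z s \<omega>)) (\<lambda>s. D s \<omega>) {0<..\<tau> \<omega>} \<and>
        (\<forall>t\<in>{0..\<tau> \<omega>}.
           v t \<omega> = \<xi> \<omega> - h (\<tau> \<omega>) \<omega> (left_lim v (\<tau> \<omega>) \<omega>) (\<xi> \<omega>)
             - ls_integral (\<lambda>s. f s \<omega> (left_lim v s \<omega>) (v s \<omega>) (z s \<omega>)) (\<lambda>s. D s \<omega>) {t<..\<tau> \<omega>}
             - stoch_integral_upto P F \<tau> z M t \<omega>
             - (\<Sum>\<^sub>\<infinity>s\<in>{t..<\<tau> \<omega>}. h s \<omega> (left_lim v s \<omega>) (right_lim v s \<omega>))))"

definition cadlag_bsde_solution ::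
  "'a measure \<Rightarrow> (real \<Rightarrow> 'a measure) \<Rightarrow> ('a \<Rightarrow> real) \<Rightarrow> ('a \<Rightarrow> real) \<Rightarrow>
    (real \<Rightarrow> 'a \<Rightarrow> real \<Rightarrow> real \<Rightarrow> real^'d \<Rightarrow> real) \<Rightarrow> (real \<Rightarrow> 'a \<Rightarrow> real \<Rightarrow> real \<Rightarrow> real) \<Rightarrow>
    (real \<Rightarrow> 'a \<Rightarrow> real) \<Rightarrow> (real \<Rightarrow> 'a \<Rightarrow> real^'d) \<Rightarrow>
    (real \<Rightarrow> 'a \<Rightarrow> real) \<Rightarrow> (real \<Rightarrow> 'a \<Rightarrow> real^'d) \<Rightarrow> bool" where
  "cadlag_bsde_solution P F \<tau> \<xi> f h D M y z \<longleftrightarrow>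
     optional_process P F y \<and> predictable_process P F z \<and> cadlag P y \<and> stopped_at P \<tau> y \<and>
     stoch_integrable P F (restrict_to \<tau> z) M \<and>
     (AE \<omega> in P.
        ls_integrable (\<lambda>s. f s \<omega> (left_lim y s \<omega>) (y s \<omega>) (z s \<omega>)) (\<lambda>s. D s \<omega>) {0<..\<tau> \<omega>} \<and>
        (\<forall>t\<in>{0..\<tau> \<omega>}.
           y t \<omega> = \<xi> \<omega>
             - ls_integral (\<lambda>s. f s \<omega> (left_lim y s \<omega>) (y s \<omega>) (z s \<omega>)) (\<lambda>s. D s \<omega>) {t<..\<tau> \<omega>}
             - (\<Sum>\<^sub>\<infinity>s\<in>{t<..\<tau> \<omega>}. h s \<omega> (left_lim y s \<omega>) (y s \<omega>))
             - stoch_integral_upto P F \<tau> z M t \<omega>))"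

end

theory Submission
  imports Defs
begin

text \<open>
  Letting \<open>u \<down> t\<close> in the equation for \<open>v\<close> shows that \<open>v\<^bsub>t+\<^esub>\<close> solves the same equation with the sum
  over \<open>t < s < \<tau>\<close>: the Stieltjes and stochastic integrals are right-continuous in their lower limit,
  and \<open>h\<close> charges finitely many times only. Hence \<open>v\<^sub>+\<close> and \<open>v\<close> differ at finitely many times, a set
  which the continuous path \<open>D\<^sup>c\<close> does not charge, while \<open>v\<^sub>+\<close> has the same left limits as \<open>v\<close>. The
  equation at \<open>\<tau>\<close> gives \<open>y\<^sub>\<tau> = v\<^sub>\<tau> + h(\<tau>, v\<^bsub>\<tau>-\<^esub>, \<xi>) = \<xi>\<close> almost surely. Since \<open>h\<close> need not be measurable,
  this identity and the completeness of the filtration are what make \<open>y\<close> adapted, and thus, being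
  cadlag, optional.
\<close>

section \<open>Lebesgue-Stieltjes integrals\<close>

text \<open>Two decompositions \<open>A = G - H = G' - H'\<close> are compared through
  \<open>G + H' = G' + H\<close>. As an identity between sums of measures this involves no
  subtraction of possibly infinite quantities.\<close>

definition sum_measure :: "'a measure \<Rightarrow> 'a measure \<Rightarrow> 'a measure" where
  "sum_measure M N = measure_of (space M) (sets M) (\<lambda>A. emeasure M A + emeasure N A)"

lemma sets_sum_measure [simp, measurable_cong]: "sets (sum_measure M N) = sets M"
  by (simp add: sum_measure_def)

lemma space_sum_measure [simp]: "space (sum_measure M N) = space M"
  by (simp add: sum_measure_def)

lemma emeasure_sum_measure:
  assumes "sets N = sets M" "A \<in> sets M"
  shows "emeasure (sum_measure M N) A = emeasure M A + emeasure N A"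
  unfolding sum_measure_def
proof (rule emeasure_measure_of_sigma)
  show "countably_additive (sets M) (\<lambda>A. emeasure M A + emeasure N A)"
    using assms by (auto simp: countably_additive_def suminf_add[symmetric] suminf_emeasure)
qed (use assms in \<open>auto simp: positive_def sets.sigma_algebra_axioms\<close>)

lemma nn_integral_sum_measure:
  assumes N: "sets N = sets M" and f: "f \<in> borel_measurable M"
  shows "integral\<^sup>N (sum_measure M N) f = integral\<^sup>N M f + integral\<^sup>N N f"
  using f
proof (induction rule: borel_measurable_induct)
  case (cong f g)
  then show ?case
    using sets_eq_imp_space_eq[OF N] nn_integral_cong[of "sum_measure M N" f g]
      nn_integral_cong[of M f g] nn_integral_cong[of N f g] by simp
next
  case (set A)
  then show ?case by (simp add: N emeasure_sum_measure)
next
  case (mult u c)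
  then show ?case
    by (simp add: nn_integral_cmult N measurable_cong_sets[OF N] distrib_left
      measurable_cong_sets[OF sets_sum_measure])
next
  case (add u v)
  then show ?case
    by (simp add: nn_integral_add N measurable_cong_sets[OF N]
      measurable_cong_sets[OF sets_sum_measure] ac_simps)
next
  case (seq U)
  have "integral\<^sup>N (sum_measure M N) (SUP i. U i) = (SUP i. integral\<^sup>N (sum_measure M N) (U i))"
    using seq by (subst nn_integral_monotone_convergence_SUP[symmetric])
      (auto simp: image_comp measurable_cong_sets[OF sets_sum_measure] intro!: nn_integral_cong)
  also have "\<dots> = (SUP i. integral\<^sup>N M (U i)) + (SUP i. integral\<^sup>N N (U i))"
    using seq by (simp add: ennreal_SUP_add incseq_def nn_integral_mono le_fun_def)
  also have "(SUP i. integral\<^sup>N M (U i)) = integral\<^sup>N M (SUP i. U i)"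
    using seq by (subst nn_integral_monotone_convergence_SUP[symmetric])
      (auto simp: image_comp intro!: nn_integral_cong)
  also have "(SUP i. integral\<^sup>N N (U i)) = integral\<^sup>N N (SUP i. U i)"
    using seq by (subst nn_integral_monotone_convergence_SUP[symmetric])
      (auto simp: image_comp measurable_cong_sets[OF N] intro!: nn_integral_cong)
  finally show ?case .
qed

definition ls_integrator :: "(real \<Rightarrow> real) \<Rightarrow> bool" where
  "ls_integrator G \<longleftrightarrow> mono G \<and> (\<forall>t. continuous (at_right t) G)"

lemma emeasure_ls_integrator_Ioc:
  "ls_integrator G \<Longrightarrow> a \<le> b \<Longrightarrow> emeasure (interval_measure G) {a<..b} = ennreal (G b - G a)"
  by (rule emeasure_interval_measure_Ioc) (auto simp: ls_integrator_def monoD)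

text \<open>The identity of the functions is known on \<open>[0, \<infinity>)\<close> only, so the
  measures are cut down to \<open>{0<..}\<close> by a density. They then agree on half-open
  intervals, an intersection-stable generator of the Borel sets, and bounded intervals of finite
  mass exhaust the line.\<close>

lemma ls_integrator_sum_measure_eq:
  assumes G: "ls_integrator G1" "ls_integrator G2" "ls_integrator G3" "ls_integrator G4"
    and eq: "\<And>t. 0 \<le> t \<Longrightarrow> G1 t + G2 t = G3 t + G4 t"
  defines "pos \<equiv> \<lambda>G. density (interval_measure G) (indicator {0<..})"
  shows "sum_measure (pos G1) (pos G2) = sum_measure (pos G3) (pos G4)" (is "?M = ?N")
proof -
  define E where "E = range (\<lambda>(a, b). {a<..b::real})"
  have sets: "sets (pos G) = sets borel" for G by (simp add: pos_def)
  \<comment> \<open>The cut at 0 turns the end points into \<open>max 0 a\<close> and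
    \<open>max 0 b\<close>, at which the hypothesis on the functions applies.\<close>
  have pos: "emeasure (pos G) {a<..b} = (if a \<le> b then ennreal (G (max 0 b) - G (max 0 a)) else 0)"
    if "ls_integrator G" for G a b
  proof -
    have "{0<..} \<inter> {a<..b} = {max 0 a<..max 0 b}" by auto
    then show ?thesis
      unfolding pos_def using that
      by (subst emeasure_density)
        (auto simp: indicator_inter_arith[symmetric] emeasure_ls_integrator_Ioc max_def)
  qed
  have m: "G x \<le> G y" if "ls_integrator G" "x \<le> y" for G x y
    using that by (auto simp: ls_integrator_def monoD)
  have s: "ennreal (G1 (max 0 b) - G1 (max 0 a)) + ennreal (G2 (max 0 b) - G2 (max 0 a)) =
     ennreal (G3 (max 0 b) - G3 (max 0 a)) + ennreal (G4 (max 0 b) - G4 (max 0 a))" if "a \<le> b" for a b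
  proof -
    have "max 0 a \<le> max 0 b" using that by auto
    then show ?thesis
      using G m eq[of "max 0 a"] eq[of "max 0 b"]
      by (subst (1 2) ennreal_plus[symmetric]) (auto simp: algebra_simps)
  qed
  have fin: "emeasure ?M {a<..b} \<noteq> \<top>" for a b
    by (simp add: emeasure_sum_measure sets pos G)
  show ?thesis
  proof (rule measure_eqI_generator_eq[where E=E and \<Omega>=UNIV and A="\<lambda>n. {- real n<..real n}"])
    show "Int_stable E"
      by (auto simp: Int_stable_def E_def)
    show "sets ?M = sigma_sets UNIV E" "sets ?N = sigma_sets UNIV E"
      by (simp_all add: sets borel_sigma_sets_Ioc E_def case_prod_unfold image_def)
    show "emeasure ?M X = emeasure ?N X" if "X \<in> E" for X
      using that s by (auto simp: E_def emeasure_sum_measure sets pos G)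
    show "(\<Union>i. {- real i<..real i}) = UNIV"
    proof (safe)
      fix x :: real
      obtain n where "\<bar>x\<bar> < real n" using reals_Archimedean2 by blast
      then show "x \<in> (\<Union>i. {- real i<..real i})" by (intro UN_I[of n]) auto
    qed auto
  qed (auto simp: E_def fin)
qed

text \<open>The previous equality of measures transfers to nonnegative integrands and then to the
  positive and negative parts of \<open>g\<close>. Since \<open>g\<close> vanishes on
  \<open>t \<le> 0\<close>, integrating it over the cut measures is the same as integrating it over
  the full ones.\<close>

lemma ls_integrator_integral_eq:
  assumes G: "ls_integrator G1" "ls_integrator G2" "ls_integrator G3" "ls_integrator G4"
    and eq: "\<And>t. 0 \<le> t \<Longrightarrow> G1 t + G2 t = G3 t + G4 t"
    and g: "integrable (interval_measure G1) g" "integrable (interval_measure G2) g"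
      "integrable (interval_measure G3) g" "integrable (interval_measure G4) g"
    and g0: "\<And>t. t \<le> 0 \<Longrightarrow> g t = (0::real)"
  shows "integral\<^sup>L (interval_measure G1) g + integral\<^sup>L (interval_measure G2) g =
    integral\<^sup>L (interval_measure G3) g + integral\<^sup>L (interval_measure G4) g"
proof -
  have gb[measurable]: "g \<in> borel_measurable borel"
    using borel_measurable_integrable[OF g(1)] by simp
  define pos where "pos = (\<lambda>G. density (interval_measure G) (indicator {0<..}))"
  have sets: "sets (pos G) = sets borel" for G by (simp add: pos_def)
  \<comment> \<open>As \<open>ennreal\<close> truncates negative reals to 0, the factor
    \<open>c = 1\<close> selects the positive part of \<open>g\<close> and \<open>c = -1\<close> the
    negative part.\<close>
  have nn: "(\<integral>\<^sup>+x. ennreal (c * g x) \<partial>interval_measure G1) + (\<integral>\<^sup>+x. ennreal (c * g x) \<partial>interval_measure G2) =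
     (\<integral>\<^sup>+x. ennreal (c * g x) \<partial>interval_measure G3) + (\<integral>\<^sup>+x. ennreal (c * g x) \<partial>interval_measure G4)" for c
  proof -
    have *: "(\<integral>\<^sup>+x. ennreal (c * g x) \<partial>pos G) = (\<integral>\<^sup>+x. ennreal (c * g x) \<partial>interval_measure G)" for G
      unfolding pos_def
      by (subst nn_integral_density) (auto intro!: nn_integral_cong simp: g0 indicator_def)
    have "(\<lambda>x. ennreal (c * g x)) \<in> borel_measurable (pos G)" for G
      by (simp add: measurable_cong_sets[OF sets])
    then show ?thesis
      using nn_integral_sum_measure[of "pos G2" "pos G1" "\<lambda>x. ennreal (c * g x)"]
       nn_integral_sum_measure[of "pos G4" "pos G3" "\<lambda>x. ennreal (c * g x)"]
       ls_integrator_sum_measure_eq[OF G eq]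
      by (simp add: *[unfolded pos_def] sets pos_def)
  qed
  have fin: "(\<integral>\<^sup>+x. ennreal (c * g x) \<partial>interval_measure G) < \<top>"
    if "integrable (interval_measure G) g" for G c
    using integrable_mult_right[OF that, of c] unfolding real_integrable_def
    by (simp add: less_top)
  have "enn2real (\<integral>\<^sup>+x. ennreal (c * g x) \<partial>interval_measure G1) + enn2real (\<integral>\<^sup>+x. ennreal (c * g x) \<partial>interval_measure G2) =
     enn2real (\<integral>\<^sup>+x. ennreal (c * g x) \<partial>interval_measure G3) + enn2real (\<integral>\<^sup>+x. ennreal (c * g x) \<partial>interval_measure G4)" for c
    using nn[of c] fin g by (metis enn2real_plus)
  from this[of 1] this[of "-1"] show ?thesis
    by (simp add: real_lebesgue_integral_def g)
qed

lemma has_ls_integral_alt: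
  "has_ls_integral f A S I \<longleftrightarrow> (\<exists>G H. ls_integrator G \<and> ls_integrator H \<and> (\<forall>t\<ge>0. A t = G t - H t) \<and>
     set_integrable (interval_measure G) S f \<and> set_integrable (interval_measure H) S f \<and>
     I = (LINT s:S|interval_measure G. f s) - (LINT s:S|interval_measure H. f s))"
  unfolding has_ls_integral_def ls_integrator_def by blast

text \<open>Moving the subtracted terms across turns \<open>G - H = G' - H'\<close> into equal sums
  of measures. The inclusion of \<open>S\<close> in \<open>{0<..}\<close> makes the integrand vanish
  where the decompositions are unrelated to \<open>A\<close>.\<close>

lemma has_ls_integral_unique:
  assumes "has_ls_integral f A S I" "has_ls_integral f A S J" "S \<subseteq> {0<..}"
  shows "I = J"
proof -
  obtain G H where GH: "ls_integrator G" "ls_integrator H" "\<And>t. t \<ge> 0 \<Longrightarrow> A t = G t - H t"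
     "set_integrable (interval_measure G) S f" "set_integrable (interval_measure H) S f"
     "I = (LINT s:S|interval_measure G. f s) - (LINT s:S|interval_measure H. f s)"
    using assms(1) unfolding has_ls_integral_alt by blast
  obtain G' H' where GH': "ls_integrator G'" "ls_integrator H'" "\<And>t. t \<ge> 0 \<Longrightarrow> A t = G' t - H' t"
     "set_integrable (interval_measure G') S f" "set_integrable (interval_measure H') S f"
     "J = (LINT s:S|interval_measure G'. f s) - (LINT s:S|interval_measure H'. f s)"
    using assms(2) unfolding has_ls_integral_alt by blast
  have "G t + H' t = G' t + H t" if "t \<ge> 0" for t
    using GH(3)[OF that] GH'(3)[OF that] by simp
  moreover have "indicat_real S x *\<^sub>R f x = 0" if "x \<le> 0" for x
    using assms(3) that by (auto simp: indicator_def)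
  ultimately have "(LINT s:S|interval_measure G. f s) + (LINT s:S|interval_measure H'. f s) =
      (LINT s:S|interval_measure G'. f s) + (LINT s:S|interval_measure H. f s)"
    using GH(4,5) GH'(4,5) unfolding set_integrable_def set_lebesgue_integral_def
    by (intro ls_integrator_integral_eq[OF GH(1) GH'(2,1) GH(2)]) auto
  then show ?thesis using GH(6) GH'(6) by simp
qed

section \<open>Dependence of the Stieltjes integral on its lower limit\<close>

lemma ls_integral_eqI:
  "has_ls_integral f A S I \<Longrightarrow> S \<subseteq> {0<..} \<Longrightarrow> ls_integral f A S = I"
  unfolding ls_integral_def by (blast intro: the_equality has_ls_integral_unique)

text \<open>A decomposition that works on the whole interval works on every subinterval, so one pair
  \<open>G\<close>, \<open>H\<close> represents the integrals for all lower limits at once. This is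
  what permits limits in \<open>t\<close>.\<close>

lemma ls_integral_restrict:
  assumes "ls_integrable f A {0<..b}"
  obtains G H where "\<And>t. 0 \<le> t \<Longrightarrow> ls_integral f A {t<..b} =
      (LINT s:{t<..b}|interval_measure G. f s) - (LINT s:{t<..b}|interval_measure H. f s)"
    "set_integrable (interval_measure G) {0<..b} f" "set_integrable (interval_measure H) {0<..b} f"
proof -
  obtain G H where GH: "ls_integrator G" "ls_integrator H" "\<forall>t\<ge>0. A t = G t - H t"
     "set_integrable (interval_measure G) {0<..b} f" "set_integrable (interval_measure H) {0<..b} f"
    using assms unfolding ls_integrable_def has_ls_integral_alt by blast
  show thesis
  proof (rule that)
    fix t :: real assume "0 \<le> t"
    then have "set_integrable (interval_measure G) {t<..b} f" "set_integrable (interval_measure H) {t<..b} f"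
      using GH(4,5) by (auto elim!: set_integrable_subset)
    then show "ls_integral f A {t<..b} =
      (LINT s:{t<..b}|interval_measure G. f s) - (LINT s:{t<..b}|interval_measure H. f s)"
      using GH(1-3) \<open>0 \<le> t\<close> by (intro ls_integral_eqI) (auto simp: has_ls_integral_alt)
  qed (use GH in auto)
qed

lemma ls_integral_empty:
  assumes "ls_integrable f A {0<..b}" "0 \<le> b"
  shows "ls_integral f A {b<..b} = 0"
proof -
  obtain G H where "\<And>t. 0 \<le> t \<Longrightarrow> ls_integral f A {t<..b} =
      (LINT s:{t<..b}|interval_measure G. f s) - (LINT s:{t<..b}|interval_measure H. f s)"
    using ls_integral_restrict[OF assms(1)] by blast
  from this[OF assms(2)] show ?thesis by (simp add: set_lebesgue_integral_def)
qed

text \<open>The intervals \<open>{u<..b}\<close> increase to \<open>{t<..b}\<close> as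
  \<open>u\<close> decreases to \<open>t\<close>. The point \<open>t\<close> belongs to none of
  them, so an atom there does no harm.\<close>

lemma ls_integral_tendsto_right:
  assumes "ls_integrable f A {0<..b}" "0 \<le> t" "t < b"
  shows "((\<lambda>u. ls_integral f A {u<..b}) \<longlongrightarrow> ls_integral f A {t<..b}) (at_right t)"
proof -
  obtain G H where GH: "\<And>t. 0 \<le> t \<Longrightarrow> ls_integral f A {t<..b} =
      (LINT s:{t<..b}|interval_measure G. f s) - (LINT s:{t<..b}|interval_measure H. f s)"
    "set_integrable (interval_measure G) {0<..b} f" "set_integrable (interval_measure H) {0<..b} f"
    using ls_integral_restrict[OF assms(1)] by blast
  have lim: "((\<lambda>u. LINT s:{u<..b}|interval_measure G. f s) \<longlongrightarrow> (LINT s:{t<..b}|interval_measure G. f s)) (at_right t)"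
    if "set_integrable (interval_measure G) {0<..b} f" for G
  proof (rule tendsto_at_right_sequentially[OF \<open>t < b\<close>])
    fix S :: "nat \<Rightarrow> real" assume S: "\<And>n. t < S n" "decseq S" "S \<longlonglongrightarrow> t"
    have U: "(\<Union>n. {S n<..b}) = {t<..b}"
    proof safe
      fix x assume x: "x \<in> {t<..b}"
      then have "eventually (\<lambda>n. S n < x) sequentially"
        using S(3) by (auto dest: order_tendstoD(2))
      then show "x \<in> (\<Union>n. {S n<..b})" using x by (auto simp: eventually_sequentially)
    next
      fix x n assume "x \<in> {S n<..b}" then show "x \<in> {t<..b}" using S(1)[of n] by auto
    qed
    have "set_integrable (interval_measure G) {t<..b} f"
      using that \<open>0 \<le> t\<close> by (auto elim!: set_integrable_subset)
    then show "(\<lambda>n. LINT s:{S n<..b}|interval_measure G. f s) \<longlonglongrightarrow> (LINT s:{t<..b}|interval_measure G. f s)"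
      using set_integral_cont_up[of "\<lambda>n. {S n<..b}" "interval_measure G" f] S(2)
      unfolding U by (force simp: incseq_def decseq_def)
  qed
  have "eventually (\<lambda>u. (LINT s:{u<..b}|interval_measure G. f s) - (LINT s:{u<..b}|interval_measure H. f s)
      = ls_integral f A {u<..b}) (at_right t)"
    using eventually_at_right_less[of t] by eventually_elim (use GH(1) \<open>0 \<le> t\<close> in auto)
  from Lim_transform_eventually[OF tendsto_diff[OF lim[OF GH(2)] lim[OF GH(3)]] this]
  show ?thesis using GH(1) \<open>0 \<le> t\<close> by simp
qed

section \<open>Changing the integrand at finitely many times\<close>

lemma interval_measure_singleton_tendsto:
  assumes "ls_integrator G"
  shows "((\<lambda>u. G s - G u) \<longlongrightarrow> measure (interval_measure G) {s}) (at_left s)"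
proof (rule tendsto_at_left_sequentially[of "s - 1"])
  fix S :: "nat \<Rightarrow> real" assume S: "\<And>n. S n < s" "incseq S" "S \<longlonglongrightarrow> s"
  \<comment> \<open>The atom at \<open>s\<close> is the mass of a decreasing intersection of
    half-open intervals, hence the left jump of \<open>G\<close> at \<open>s\<close>.\<close>
  have I: "(\<Inter>n. {S n<..s}) = {s}"
  proof safe
    fix x assume x: "x \<in> (\<Inter>n. {S n<..s})"
    then have "\<And>n. S n \<le> x" by (auto intro: less_imp_le)
    then have "s \<le> x" using S(3) by (blast intro: LIMSEQ_le_const2)
    then show "x = s" using x by auto
  qed (use S in auto)
  have "(\<lambda>n. measure (interval_measure G) {S n<..s}) \<longlonglongrightarrow> measure (interval_measure G) (\<Inter>n. {S n<..s})"
  proof (intro Lim_measure_decseq)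
    show "decseq (\<lambda>n. {S n<..s})" using S(2) by (fastforce simp: decseq_def incseq_def intro: le_less_trans)
  qed (use S(1) in \<open>auto simp: emeasure_ls_integrator_Ioc[OF assms] less_imp_le\<close>)

  then show "(\<lambda>n. G s - G (S n)) \<longlonglongrightarrow> measure (interval_measure G) {s}"
    unfolding I using assms S(1) by (subst (asm) measure_interval_measure_Ioc)
     (auto simp: ls_integrator_def monoD less_imp_le)
qed simp

text \<open>Such a \<open>g\<close> is a finite combination of indicators of singletons;
  measurability and integrability come from this representation, so that integrands without known
  measurability can be treated.\<close>

lemma has_bochner_integral_finite_support:
  fixes g :: "'a \<Rightarrow> real"
  assumes C: "finite C" "\<And>s. s \<in> C \<Longrightarrow> {s} \<in> sets M" "\<And>s. s \<in> C \<Longrightarrow> emeasure M {s} < \<infinity>"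
    and g: "\<And>s. s \<notin> C \<Longrightarrow> g s = 0"
  shows "has_bochner_integral M g (\<Sum>s\<in>C. measure M {s} * g s)"
proof -
  have "has_bochner_integral M (\<lambda>x. \<Sum>s\<in>C. indicator {s} x *\<^sub>R g s) (\<Sum>s\<in>C. measure M {s} *\<^sub>R g s)"
    using C by (intro has_bochner_integral_sum has_bochner_integral_indicator) auto
  moreover have "(\<Sum>s\<in>C. indicator {s} x *\<^sub>R g s) = g x" for x
    using C(1) g[of x] by (cases "x \<in> C") (auto simp: indicator_def sum.delta)
  ultimately show ?thesis by simp
qed

text \<open>Only the difference \<open>A = G - H\<close> is left-continuous; \<open>G\<close> and \<open>H\<close> may have common jumps,
  whose contributions cancel.\<close>

lemma has_ls_integral_cong_finite:
  assumes I: "has_ls_integral f A S I" and S: "S \<subseteq> {0<..}"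
    and C: "finite C" and eq: "\<And>s. s \<in> S - C \<Longrightarrow> f' s = f s"
    and A: "\<And>s. s \<in> S \<Longrightarrow> (A \<longlongrightarrow> A s) (at_left s)"
  shows "has_ls_integral f' A S I"
proof -
  obtain G H where GH: "ls_integrator G" "ls_integrator H" "\<And>t. t \<ge> 0 \<Longrightarrow> A t = G t - H t"
     "set_integrable (interval_measure G) S f" "set_integrable (interval_measure H) S f"
     "I = (LINT s:S|interval_measure G. f s) - (LINT s:S|interval_measure H. f s)"
    using I unfolding has_ls_integral_alt by blast
  \<comment> \<open>The change of integrand on \<open>S\<close>. It lives on the finite set
    \<open>C \<inter> S\<close>, and \<open>K L\<close> is its integral against \<open>L\<close>;
    the measurability of \<open>f'\<close> is inherited from that of \<open>f\<close> and
    \<open>g\<close>.\<close>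
  define g where "g x = indicat_real S x * (f' x - f x)" for x
  define K where "K L = (\<Sum>s\<in>C \<inter> S. measure (interval_measure L) {s} * g s)" for L
  have fin: "emeasure (interval_measure L) {s} < \<infinity>" if "ls_integrator L" for L s
  proof -
    have "emeasure (interval_measure L) {s} \<le> emeasure (interval_measure L) {s - 1<..s}"
      by (rule emeasure_mono) auto
    also have "\<dots> < \<infinity>" using that by (simp add: emeasure_ls_integrator_Ioc)
    finally show ?thesis .
  qed
  have g: "has_bochner_integral (interval_measure L) g (K L)" if "ls_integrator L" for L
    unfolding K_def using C eq fin[OF that]
    by (intro has_bochner_integral_finite_support) (auto simp: g_def indicator_def)
  have f': "has_bochner_integral (interval_measure L) (\<lambda>x. indicat_real S x *\<^sub>R f' x)
      ((LINT s:S|interval_measure L. f s) + K L)"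
    if "ls_integrator L" "set_integrable (interval_measure L) S f" for L
  proof -
    have "has_bochner_integral (interval_measure L) (\<lambda>x. indicat_real S x *\<^sub>R f x + g x)
      ((LINT s:S|interval_measure L. f s) + K L)"
      using that unfolding set_integrable_def set_lebesgue_integral_def
      by (intro has_bochner_integral_add g has_bochner_integral_integrable)
    also have "(\<lambda>x. indicat_real S x *\<^sub>R f x + g x) = (\<lambda>x. indicat_real S x *\<^sub>R f' x)"
      by (auto simp: g_def algebra_simps)
    finally show ?thesis .
  qed
  \<comment> \<open>The difference of the two atoms is the left jump of \<open>A\<close> at
    \<open>s\<close>, which is 0. Since \<open>A = G - H\<close> holds only at nonnegative times,
    the comparison uses points between 0 and \<open>s\<close>.\<close>
  have "measure (interval_measure G) {s} = measure (interval_measure H) {s}" if "s \<in> S" for s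
  proof -
    have "0 < s" using that S by auto
    have "((\<lambda>u. A s - A u) \<longlongrightarrow> 0) (at_left s)"
      using tendsto_diff[OF tendsto_const A[OF that], of "A s"] by simp
    moreover have "eventually (\<lambda>u. (G s - G u) - (H s - H u) = A s - A u) (at_left s)"
      using eventually_at_leftI[of 0 s "\<lambda>u. 0 < u"] \<open>0 < s\<close>
      by (auto elim!: eventually_mono simp: GH(3))
    then have "((\<lambda>u. A s - A u) \<longlongrightarrow> measure (interval_measure G) {s} - measure (interval_measure H) {s}) (at_left s)"
      using interval_measure_singleton_tendsto[OF GH(1)] interval_measure_singleton_tendsto[OF GH(2)]
      by (blast intro: Lim_transform_eventually tendsto_diff)
    ultimately show ?thesis
      using tendsto_unique[OF trivial_limit_at_left_real] by fastforce
  qed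
  then have "K G = K H" by (simp add: K_def)
  then show ?thesis
    using GH f'[OF GH(1,4)] f'[OF GH(2,5)] unfolding has_ls_integral_alt
    by (intro exI[of _ G] exI[of _ H])
      (auto simp: has_bochner_integral_iff set_integrable_def set_lebesgue_integral_def)
qed

text \<open>The hypotheses are symmetric in \<open>f\<close> and \<open>f'\<close>, so both have
  exactly the same candidate values. Hence the integrals also agree as terms, whether or not one
  exists.\<close>

lemma ls_integral_cong_finite:
  assumes "S \<subseteq> {0<..}" "finite C" "\<And>s. s \<in> S - C \<Longrightarrow> f' s = f s"
    and "\<And>s. s \<in> S \<Longrightarrow> (A \<longlongrightarrow> A s) (at_left s)"
  shows "ls_integral f' A S = ls_integral f A S" and "ls_integrable f' A S = ls_integrable f A S"
proof -
  have "has_ls_integral f' A S I = has_ls_integral f A S I" for I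
    using has_ls_integral_cong_finite[of f A S I C f'] has_ls_integral_cong_finite[of f' A S I C f] assms
    by metis
  then show "ls_integral f' A S = ls_integral f A S" "ls_integrable f' A S = ls_integrable f A S"
    by (simp_all add: ls_integral_def ls_integrable_def)
qed

section \<open>One-sided limits and jumps of paths\<close>

lemma abs_Lim_diff_le:
  fixes F :: "real filter" and u :: "real \<Rightarrow> real"
  assumes "F \<noteq> bot" "(u \<longlongrightarrow> r) F" "eventually (\<lambda>s. \<bar>u s - l\<bar> \<le> e) F"
  shows "\<bar>Lim F u - l\<bar> \<le> e"
proof -
  have "((\<lambda>s. \<bar>u s - l\<bar>) \<longlongrightarrow> \<bar>r - l\<bar>) F"
    using assms(2) by (intro tendsto_intros)
  then have "\<bar>r - l\<bar> \<le> e"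
    using tendsto_upperbound[OF _ assms(3,1)] by blast
  then show ?thesis using tendsto_Lim[OF assms(1,2)] by simp
qed

lemma right_limits_close:
  fixes u :: "real \<Rightarrow> real"
  assumes ex: "\<And>t. t \<in> {a<..<b} \<Longrightarrow> \<exists>r. (u \<longlongrightarrow> r) (at_right t)"
    and u: "\<And>s. s \<in> {a<..<b} \<Longrightarrow> \<bar>u s - l\<bar> < e" and s: "s \<in> {a<..<b}"
  shows "\<bar>Lim (at_right s) u - l\<bar> \<le> e"
proof -
  obtain r where r: "(u \<longlongrightarrow> r) (at_right s)" using ex[OF s] by blast
  have "eventually (\<lambda>x. \<bar>u x - l\<bar> \<le> e) (at_right s)"
    using s u by (intro eventually_at_rightI[of s b]) (auto intro!: less_imp_le)
  then show ?thesis by (intro abs_Lim_diff_le[OF _ r]) simp_all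
qed

lemma right_limits_tendsto_right:
  fixes u :: "real \<Rightarrow> real"
  assumes ex: "\<And>t. 0 \<le> t \<Longrightarrow> \<exists>r. (u \<longlongrightarrow> r) (at_right t)" and t: "0 \<le> t"
    and l: "(u \<longlongrightarrow> l) (at_right t)"
  shows "((\<lambda>s. Lim (at_right s) u) \<longlongrightarrow> l) (at_right t)"
proof (rule tendstoI)
  fix e :: real assume "0 < e"
  \<comment> \<open>Half of \<open>e\<close> is taken because passing to right limits keeps only the
    weak inequality.\<close>
  then have "eventually (\<lambda>s. dist (u s) l < e/2) (at_right t)" by (intro tendstoD[OF l]) auto
  then obtain b where b: "t < b" "\<And>s. s \<in> {t<..<b} \<Longrightarrow> \<bar>u s - l\<bar> < e/2"
    by (auto simp: eventually_at_right_field dist_real_def)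
  show "eventually (\<lambda>s. dist (Lim (at_right s) u) l < e) (at_right t)"
  proof (rule eventually_at_rightI[OF _ b(1)])
    fix s assume "s \<in> {t<..<b}"
    from right_limits_close[where u=u, OF _ b(2) this] ex t \<open>0 < e\<close> show "dist (Lim (at_right s) u) l < e"
      by (fastforce simp: dist_real_def)
  qed
qed

lemma right_limits_tendsto_left:
  fixes u :: "real \<Rightarrow> real"
  assumes ex: "\<And>t. 0 \<le> t \<Longrightarrow> \<exists>r. (u \<longlongrightarrow> r) (at_right t)" and t: "0 < t"
    and l: "(u \<longlongrightarrow> l) (at_left t)"
  shows "((\<lambda>s. Lim (at_right s) u) \<longlongrightarrow> l) (at_left t)"
proof (rule tendstoI)
  fix e :: real assume "0 < e"
  then have "eventually (\<lambda>s. dist (u s) l < e/2) (at_left t)" by (intro tendstoD[OF l]) auto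
  then obtain b where b: "b < t" "\<And>s. s \<in> {b<..<t} \<Longrightarrow> \<bar>u s - l\<bar> < e/2"
    by (auto simp: eventually_at_left_field dist_real_def)
  \<comment> \<open>Right limits are known to exist at nonnegative times only, so the neighbourhood
    is shortened to stay above 0.\<close>
  have c: "max b 0 < t" "\<And>s. s \<in> {max b 0<..<t} \<Longrightarrow> \<bar>u s - l\<bar> < e/2" using b t by auto
  show "eventually (\<lambda>s. dist (Lim (at_right s) u) l < e) (at_left t)"
  proof (rule eventually_at_leftI[OF _ c(1)])
    fix s assume "s \<in> {max b 0<..<t}"
    from right_limits_close[where u=u, OF _ c(2) this] ex \<open>0 < e\<close> show "dist (Lim (at_right s) u) l < e"
      by (fastforce simp: dist_real_def)
  qed
qed

text \<open>Each jump is approximated by an increment of \<open>D\<close> over a short interval ending at the jump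
  time.\<close>

lemma jumps_le_increments:
  fixes D :: "real \<Rightarrow> real"
  assumes L: "\<And>t. 0 < t \<Longrightarrow> (D \<longlongrightarrow> L t) (at_left t)" and "finite J" "J \<subseteq> {0<..b}" "0 < e" "0 \<le> b"
  shows "\<exists>(n::nat) u. 0 \<le> u 0 \<and> mono u \<and> u n \<le> b \<and>
    (\<Sum>s\<in>J. \<bar>D s - L s\<bar>) \<le> (\<Sum>i<n. \<bar>D (u (Suc i)) - D (u i)\<bar>) + e"
  using assms(2-)
proof (induction J arbitrary: b e rule: finite_linorder_max_induct)
  case empty
  then show ?case by (intro exI[of _ 0] exI[of _ "\<lambda>_. 0"]) (auto simp: mono_def)
next
  case (insert m J)
  have m: "0 < m" "m \<le> b" using insert.prems by auto
  \<comment> \<open>The last jump time before \<open>m\<close>, or 0 if there is none. The partition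
    for the earlier jumps is built on \<open>[0, c]\<close> with half the error.\<close>
  define c where "c = Max (insert 0 J)"
  have c: "J \<subseteq> {0<..c}" "0 \<le> c" "c < m"
    using insert m by (auto simp: c_def)
  from insert.IH[OF c(1) _ c(2), of "e/2"] insert.prems obtain n u where
    u: "0 \<le> u 0" "mono u" "u n \<le> c"
      "(\<Sum>s\<in>J. \<bar>D s - L s\<bar>) \<le> (\<Sum>i<n. \<bar>D (u (Suc i)) - D (u i)\<bar>) + e/2" by auto
  have "eventually (\<lambda>a. dist (D a) (L m) < e/2) (at_left m)"
    using insert.prems by (intro tendstoD[OF L[OF m(1)]]) auto
  moreover have "eventually (\<lambda>a. c < a \<and> a < m) (at_left m)"
    using c(3) by (intro eventually_at_leftI[of c]) auto
  ultimately have "eventually (\<lambda>a. dist (D a) (L m) < e/2 \<and> c < a \<and> a < m) (at_left m)"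
    by eventually_elim auto
  then obtain a where a: "\<bar>D a - L m\<bar> < e/2" "c < a" "a < m"
    using eventually_happens'[of "at_left m"] by (auto simp: dist_real_def)
  \<comment> \<open>The partition is prolonged by \<open>a\<close> and \<open>m\<close>. The
    increment from \<open>u n\<close> to \<open>a\<close> is discarded in the estimate below, and
    replacing \<open>L m\<close> by the value of \<open>D\<close> at \<open>a\<close> costs the
    other half of the error.\<close>
  define w where "w i = (if i \<le> n then u i else if i = Suc n then a else m)" for i
  have "mono w"
    using u(2,3) a unfolding mono_def w_def by (fastforce intro: order_trans[of "u _" "u n"])
  moreover have "(\<Sum>i<Suc (Suc n). \<bar>D (w (Suc i)) - D (w i)\<bar>) \<ge>
      (\<Sum>i<n. \<bar>D (u (Suc i)) - D (u i)\<bar>) + \<bar>D m - D a\<bar>"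
    by (simp add: w_def)
  moreover have "\<bar>D m - L m\<bar> \<le> \<bar>D m - D a\<bar> + e/2" using a(1) by linarith
  moreover have "m \<notin> J" using insert by auto
  moreover have "w 0 = u 0" "w (Suc (Suc n)) = m" by (simp_all add: w_def)
  ultimately show ?case
    using u m insert.hyps(1)
    by (intro exI[of _ "Suc (Suc n)"] exI[of _ w]) (simp del: sum.lessThan_Suc)
qed

text \<open>The left limit at \<open>t\<close> is the left limit of \<open>D\<close> minus the jumps
  strictly before \<open>t\<close>. Adding the jump at \<open>t\<close> to both terms gives the
  value at \<open>t\<close>.\<close>

lemma continuous_part_left_continuous:
  assumes D: "cadlag P D" "finite_variation P D" and \<omega>: "\<omega> \<in> space P" and t: "0 < t"
  shows "((\<lambda>s. continuous_part D s \<omega>) \<longlongrightarrow> continuous_part D t \<omega>) (at_left t)"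
proof -
  define L where "L s = left_lim D s \<omega>" for s
  have L: "((\<lambda>s. D s \<omega>) \<longlongrightarrow> L s) (at_left s)" if s: "0 < s" for s
  proof -
    obtain l where "((\<lambda>s. D s \<omega>) \<longlongrightarrow> l) (at_left s)"
      using D(1) \<omega> s by (force simp: cadlag_def)
    then show ?thesis using s tendsto_Lim[of "at_left s" "\<lambda>s. D s \<omega>"] by (simp add: L_def left_lim_def)
  qed
  obtain K where K: "\<And>n u. 0 \<le> u 0 \<Longrightarrow> mono u \<Longrightarrow> u n \<le> t \<Longrightarrow>
      (\<Sum>i<n. \<bar>D (u (Suc i)) \<omega> - D (u i) \<omega>\<bar>) \<le> K"
    using D(2) \<omega> t unfolding finite_variation_def by (meson less_imp_le)
  \<comment> \<open>Finite sums of jump sizes are bounded by the variation on \<open>[0, t]\<close>,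
    up to the allowed error 1; this gives absolute summability.\<close>
  have "(\<Sum>s\<in>J. \<bar>jump D s \<omega>\<bar>) \<le> K + 1" if J: "finite J" "J \<subseteq> {0<..t}" for J
    using jumps_le_increments[of "\<lambda>s. D s \<omega>" L, OF L J, of 1] K t
    by (fastforce simp: jump_def L_def)
  then have sum: "(\<lambda>s. norm (jump D s \<omega>)) summable_on {0<..t}"
    by (intro nonneg_bdd_above_summable_on) (auto intro!: bdd_aboveI[of _ "K + 1"])
  have sm: "(\<lambda>s. jump D s \<omega>) summable_on A" if "A \<subseteq> {0<..t}" for A
    using summable_on_subset_banach[OF abs_summable_summable[OF sum] that] by blast
  have "((\<lambda>u. \<Sum>\<^sub>\<infinity>s\<in>{0<..u}. jump D s \<omega>) \<longlongrightarrow> (\<Sum>\<^sub>\<infinity>s\<in>{0<..<t}. jump D s \<omega>)) (at_left t)"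
  proof (rule tendstoI)
    fix e :: real assume "0 < e"
    have "((\<lambda>s. norm (jump D s \<omega>)) has_sum (\<Sum>\<^sub>\<infinity>s\<in>{0<..<t}. norm (jump D s \<omega>))) {0<..<t}"
      using sum by (intro has_sum_infsum) (auto elim: summable_on_subset_banach)
    from has_sum_finite_approximation[OF this, of "e/2"] \<open>0 < e\<close> obtain J where
      J: "finite J" "J \<subseteq> {0<..<t}"
        "dist (\<Sum>s\<in>J. norm (jump D s \<omega>)) (\<Sum>\<^sub>\<infinity>s\<in>{0<..<t}. norm (jump D s \<omega>)) \<le> e/2" by auto
    \<comment> \<open>Beyond \<open>c\<close> all of \<open>J\<close> is included in
      \<open>{0<..u}\<close>, so the remaining jumps in \<open>R\<close> have total size at most
      \<open>e/2\<close>.\<close>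
    define c where "c = Max (insert 0 J)"
    have c: "J \<subseteq> {0<..c}" "0 \<le> c" "c < t" using J t by (auto simp: c_def)
    show "eventually (\<lambda>u. dist (\<Sum>\<^sub>\<infinity>s\<in>{0<..u}. jump D s \<omega>) (\<Sum>\<^sub>\<infinity>s\<in>{0<..<t}. jump D s \<omega>) < e) (at_left t)"
    proof (rule eventually_at_leftI[OF _ c(3)])
      fix u assume u: "u \<in> {c<..<t}"
      define R where "R = {0<..<t} - {0<..u}"
      have nsm: "(\<lambda>s. norm (jump D s \<omega>)) summable_on A" if "A \<subseteq> {0<..t}" for A
        using summable_on_subset_banach[OF sum that] .
      have split: "infsum g {0<..<t} = infsum g {0<..u} + infsum g R"
        if "g summable_on {0<..t}" for g :: "real \<Rightarrow> real"
      proof -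
        have "infsum g ({0<..u} \<union> R) = infsum g {0<..u} + infsum g R"
          using u c by (intro infsum_Un_disjoint summable_on_subset_banach[OF that]) (auto simp: R_def)
        moreover have "{0<..u} \<union> R = {0<..<t}" using u c by (auto simp: R_def)
        ultimately show ?thesis by simp
      qed
      have "(\<Sum>s\<in>J. norm (jump D s \<omega>)) \<le> (\<Sum>\<^sub>\<infinity>s\<in>{0<..u}. norm (jump D s \<omega>))"
        using c u J by (intro finite_sum_le_infsum nsm) auto
      then have "(\<Sum>\<^sub>\<infinity>s\<in>R. norm (jump D s \<omega>)) \<le> e/2"
        using J(3) split[OF sum] unfolding dist_real_def by linarith
      moreover have "norm (\<Sum>\<^sub>\<infinity>s\<in>R. jump D s \<omega>) \<le> (\<Sum>\<^sub>\<infinity>s\<in>R. norm (jump D s \<omega>))"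
        by (intro norm_infsum_bound nsm) (auto simp: R_def)
      ultimately show "dist (\<Sum>\<^sub>\<infinity>s\<in>{0<..u}. jump D s \<omega>) (\<Sum>\<^sub>\<infinity>s\<in>{0<..<t}. jump D s \<omega>) < e"
        using split[OF sm[OF order_refl]] \<open>0 < e\<close> by (simp add: dist_real_def)
    qed
  qed
  from tendsto_diff[OF L[OF t] this]
  have "((\<lambda>s. continuous_part D s \<omega>) \<longlongrightarrow> L t - (\<Sum>\<^sub>\<infinity>s\<in>{0<..<t}. jump D s \<omega>)) (at_left t)"
    by (simp add: continuous_part_def)
  also have "{0<..t} = insert t {0<..<t}" using t by auto
  then have "(\<Sum>\<^sub>\<infinity>s\<in>{0<..t}. jump D s \<omega>) = jump D t \<omega> + (\<Sum>\<^sub>\<infinity>s\<in>{0<..<t}. jump D s \<omega>)"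
    using sm[of "{0<..<t}"] by (simp add: infsum_insert subset_iff)
  then have "L t - (\<Sum>\<^sub>\<infinity>s\<in>{0<..<t}. jump D s \<omega>) = continuous_part D t \<omega>"
    by (simp add: continuous_part_def jump_def L_def)
  finally show ?thesis .
qed

section \<open>Measurability\<close>

lemma usual_conditionsD:
  assumes "usual_conditions P F"
  shows "filtration (space P) F" "space (F t) = space P" "s \<le> t \<Longrightarrow> sets (F s) \<subseteq> sets (F t)"
    "N \<subseteq> A \<Longrightarrow> A \<in> null_sets P \<Longrightarrow> N \<in> sets (F 0)"
    "0 \<le> t \<Longrightarrow> sets (F t) = (\<Inter>s\<in>{t<..}. sets (F s))"
proof -
  have f: "filtration (space P) F"
    and null: "\<forall>A\<in>null_sets P. \<forall>N. N \<subseteq> A \<longrightarrow> N \<in> sets (F 0)"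
    and right: "\<forall>t\<ge>0. sets (F t) = (\<Inter>s\<in>{t<..}. sets (F s))"
    using assms unfolding usual_conditions_def by - (elim conjE, assumption)+
  show "filtration (space P) F" by (rule f)
  show "N \<subseteq> A \<Longrightarrow> A \<in> null_sets P \<Longrightarrow> N \<in> sets (F 0)" by (rule null[rule_format])
  show "0 \<le> t \<Longrightarrow> sets (F t) = (\<Inter>s\<in>{t<..}. sets (F s))" by (rule right[rule_format])
  show "space (F t) = space P" "s \<le> t \<Longrightarrow> sets (F s) \<subseteq> sets (F t)"
    using filtration.space_F[OF f] filtration.sets_F_mono[OF f] by simp_all
qed

text \<open>The section map at a fixed time is measurable from \<open>F t\<close> into the optional
  sigma-algebra; it suffices to check the generating sets, whose sections are preimages under
  adapted processes.\<close>

lemma adapted_optional_process: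
  assumes u: "usual_conditions P F" and X: "optional_process P F X"
  shows "adapted F X"
  unfolding adapted_def
proof safe
  fix t :: real assume "0 \<le> t"
  have "Pair t \<in> measurable (F t) (optional_sigma P F)"
    unfolding optional_sigma_def
  proof (rule measurable_sigma_sets[OF sets_measure_of])
    fix A assume "A \<in> {{(t, \<omega>). 0 \<le> t \<and> \<omega> \<in> space P \<and> X t \<omega> \<in> B} | X B.
        adapted F X \<and> cadlag P X \<and> B \<in> sets borel}"
    then obtain Y B where "A = {(t, \<omega>). 0 \<le> t \<and> \<omega> \<in> space P \<and> Y t \<omega> \<in> B}" "adapted F Y" "B \<in> sets borel"
      by blast
    moreover from this have "Y t -` B \<inter> space (F t) \<in> sets (F t)"
      using \<open>0 \<le> t\<close> by (auto simp: adapted_def intro: measurable_sets)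
    moreover have "Pair t -` {(t, \<omega>). 0 \<le> t \<and> \<omega> \<in> space P \<and> Y t \<omega> \<in> B} \<inter> space (F t) = Y t -` B \<inter> space (F t)"
      using \<open>0 \<le> t\<close> usual_conditionsD(2)[OF u] by auto
    ultimately show "Pair t -` A \<inter> space (F t) \<in> sets (F t)" by simp
  qed (use \<open>0 \<le> t\<close> usual_conditionsD(2)[OF u] in auto)
  from measurable_compose[OF this X[unfolded optional_process_def]]
  show "X t \<in> borel_measurable (F t)" by simp
qed

lemma optional_process_cadlag:
  assumes "adapted F X" "cadlag P X"
  shows "optional_process P F X"
  unfolding optional_process_def
proof (rule measurableI)
  fix B :: "real set" assume "B \<in> sets borel"
  have *: "{{(t, \<omega>). 0 \<le> t \<and> \<omega> \<in> space P \<and> X t \<omega> \<in> B} | X B.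
        adapted F X \<and> cadlag P X \<and> B \<in> sets borel} \<subseteq> Pow ({0..} \<times> space P)" by auto
  have "(\<lambda>(t, \<omega>). X t \<omega>) -` B \<inter> space (optional_sigma P F) = {(t, \<omega>). 0 \<le> t \<and> \<omega> \<in> space P \<and> X t \<omega> \<in> B}"
    unfolding optional_sigma_def space_measure_of[OF *] by auto
  moreover have "\<dots> \<in> sets (optional_sigma P F)"
    unfolding optional_sigma_def sets_measure_of[OF *]
    using assms \<open>B \<in> sets borel\<close>
    by (intro sigma_sets.Basic CollectI exI[of _ X] exI[of _ B] conjI refl)
  ultimately show "(\<lambda>(t, \<omega>). X t \<omega>) -` B \<inter> space (optional_sigma P F) \<in> sets (optional_sigma P F)"
    by simp
qed simp

section \<open>Adaptedness of right limits, null modifications and gluing at a stopping time\<close>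

lemma right_lim_tendsto:
  assumes "laglad P X" "\<omega> \<in> space P" "0 \<le> t"
  shows "((\<lambda>s. X s \<omega>) \<longlongrightarrow> right_lim X t \<omega>) (at_right t)"
proof -
  obtain r where "((\<lambda>s. X s \<omega>) \<longlongrightarrow> r) (at_right t)" using assms by (auto simp: laglad_def)
  then show ?thesis using tendsto_Lim[of "at_right t" "\<lambda>s. X s \<omega>"] by (simp add: right_lim_def)
qed

lemma left_lim_tendsto:
  assumes "laglad P X" "\<omega> \<in> space P" "0 < t"
  shows "((\<lambda>s. X s \<omega>) \<longlongrightarrow> left_lim X t \<omega>) (at_left t)"
proof -
  obtain r where "((\<lambda>s. X s \<omega>) \<longlongrightarrow> r) (at_left t)" using assms by (force simp: laglad_def)
  then show ?thesis
    using assms(3) tendsto_Lim[of "at_left t" "\<lambda>s. X s \<omega>"] by (simp add: left_lim_def)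
qed

text \<open>As a limit from the right, \<open>right_lim X t\<close> is measurable for
  \<open>F s\<close> with any \<open>s > t\<close>; right-continuity of the filtration brings this
  down to \<open>F t\<close>.\<close>

lemma adapted_right_lim:
  assumes u: "usual_conditions P F" and X: "adapted F X" "laglad P X"
  shows "adapted F (right_lim X)"
  unfolding adapted_def
proof safe
  fix t :: real assume t: "0 \<le> t"
  have s: "right_lim X t \<in> borel_measurable (F s)" if "t < s" for s
  proof (rule borel_measurable_LIMSEQ_real)
    fix \<omega> assume "\<omega> \<in> space (F s)"
    then have \<omega>: "\<omega> \<in> space P" using usual_conditionsD(2)[OF u] by simp
    have "(\<lambda>n. t + (s - t) * inverse (real (Suc n))) \<longlonglongrightarrow> t + (s - t) * 0"
      by (intro tendsto_intros LIMSEQ_inverse_real_of_nat)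
    then have "filterlim (\<lambda>n. t + (s - t) * inverse (real (Suc n))) (at_right t) sequentially"
      using that by (intro tendsto_imp_filterlim_at_right) auto
    then show "(\<lambda>n. X (t + (s - t) * inverse (real (Suc n))) \<omega>) \<longlonglongrightarrow> right_lim X t \<omega>"
      by (rule filterlim_compose[OF right_lim_tendsto[OF X(2) \<omega> t]])
  next
    fix n
    have "(s - t) * inverse (real (Suc n)) \<le> (s - t) * 1"
      using that by (intro mult_left_mono) (auto simp: field_simps)
    then have "subalgebra (F s) (F (t + (s - t) * inverse (real (Suc n))))"
      using usual_conditionsD(2,3)[OF u] by (simp add: subalgebra_def)
    moreover have "X (t + (s - t) * inverse (real (Suc n))) \<in> borel_measurable (F (t + (s - t) * inverse (real (Suc n))))"
      using X(1) t that by (auto simp: adapted_def)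
    ultimately show "X (t + (s - t) * inverse (real (Suc n))) \<in> borel_measurable (F s)"
      by (rule measurable_from_subalg)
  qed
  show "right_lim X t \<in> borel_measurable (F t)"
  proof (rule measurableI)
    fix B :: "real set" assume "B \<in> sets borel"
    then have "right_lim X t -` B \<inter> space P \<in> sets (F s)" if "t < s" for s
      using measurable_sets[OF s[OF that], of B] by (simp add: usual_conditionsD(2)[OF u])
    then show "right_lim X t -` B \<inter> space (F t) \<in> sets (F t)"
      unfolding usual_conditionsD(2)[OF u] usual_conditionsD(5)[OF u t] by blast
  qed simp
qed

text \<open>Preimages under \<open>U\<close> and \<open>W\<close> differ only inside a null set, and
  every subset of a null set lies in \<open>F 0\<close>. This is where completeness enters.\<close>

lemma borel_measurable_AE_eq:
  fixes U W :: "'a \<Rightarrow> real"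
  assumes u: "usual_conditions P F" and "0 \<le> t"
    and W: "W \<in> borel_measurable (F t)" and eq: "AE \<omega> in P. U \<omega> = W \<omega>"
  shows "U \<in> borel_measurable (F t)"
proof (rule measurableI)
  fix B :: "real set" assume "B \<in> sets borel"
  then have WB: "W -` B \<inter> space (F t) \<in> sets (F t)" using W by (rule measurable_sets[rotated])
  obtain A where A: "A \<in> null_sets P" "{\<omega> \<in> space P. U \<omega> \<noteq> W \<omega>} \<subseteq> A"
    using eq by (auto elim!: AE_E)
  have null: "N \<in> sets (F t)" if "N \<subseteq> {\<omega> \<in> space P. U \<omega> \<noteq> W \<omega>}" for N
    using usual_conditionsD(4)[OF u _ A(1), of N] that A(2) usual_conditionsD(3)[OF u \<open>0 \<le> t\<close>] by blast
  have "U -` B \<inter> space (F t) =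
      (W -` B \<inter> space (F t) - {\<omega> \<in> space P. U \<omega> \<noteq> W \<omega>}) \<union> {\<omega> \<in> space P. U \<omega> \<noteq> W \<omega> \<and> U \<omega> \<in> B}"
    using usual_conditionsD(2)[OF u] by auto
  also have "\<dots> \<in> sets (F t)" by (intro sets.Un sets.Diff[OF WB] null) auto
  finally show "U -` B \<inter> space (F t) \<in> sets (F t)" .
qed simp

text \<open>On \<open>{\<tau> \<le> t}\<close> an \<open>F\<^sub>\<tau>\<close>-measurable variable is \<open>F\<^sub>t\<close>-measurable.\<close>

lemma adapted_glue_at_stopping_time:
  assumes u: "usual_conditions P F" and \<tau>: "finite_stopping_time P F \<tau>"
    and X: "adapted F X" and \<xi>: "\<xi> \<in> borel_measurable (filtration.pre_sigma (space P) F \<tau>)"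
  shows "adapted F (\<lambda>t \<omega>. if t < \<tau> \<omega> then X t \<omega> else \<xi> \<omega>)"
  unfolding adapted_def
proof safe
  fix t :: real assume t: "0 \<le> t"
  interpret filtration "space P" F by (rule usual_conditionsD(1)[OF u])
  have st: "stopping_time F \<tau>" using \<tau> by (simp add: finite_stopping_time_def)
  have le: "{\<omega> \<in> space P. \<tau> \<omega> \<le> t} \<in> sets (F t)"
    using stopping_timeD[OF st, of t] by (simp add: pred_def space_F)
  show "(\<lambda>\<omega>. if t < \<tau> \<omega> then X t \<omega> else \<xi> \<omega>) \<in> borel_measurable (F t)"
  proof (rule measurableI)
    fix B :: "real set" assume B: "B \<in> sets borel"
    have "X t -` B \<inter> space P \<in> sets (F t)"
      using X t measurable_sets[OF _ B] unfolding adapted_def by (metis space_F)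
    moreover have "{\<omega> \<in> \<xi> -` B \<inter> space P. \<tau> \<omega> \<le> t} \<in> sets (F t)"
      using sets_pre_sigmaD[OF st measurable_sets[OF \<xi> B]] by (simp add: space_pre_sigma)
    moreover have "(\<lambda>\<omega>. if t < \<tau> \<omega> then X t \<omega> else \<xi> \<omega>) -` B \<inter> space (F t) =
      (X t -` B \<inter> space P - {\<omega> \<in> space P. \<tau> \<omega> \<le> t}) \<union> {\<omega> \<in> \<xi> -` B \<inter> space P. \<tau> \<omega> \<le> t}"
      by (auto simp: space_F split: if_splits)
    ultimately show "(\<lambda>\<omega>. if t < \<tau> \<omega> then X t \<omega> else \<xi> \<omega>) -` B \<inter> space (F t) \<in> sets (F t)"
      using le by auto
  qed simp
qed

section \<open>From the laglad to the cadlag equation\<close>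

text \<open>For \<open>t \<le> T\<close> the left limit only sees times before \<open>T\<close>, so
  the value at \<open>T\<close> is irrelevant. This yields both the existence of left limits of the
  new process and their equality with those of \<open>v\<close>.\<close>

lemma tendsto_left_right_lim_stopped:
  assumes v: "laglad P v" and \<omega>: "\<omega> \<in> space P" and t: "0 < t" "t \<le> T"
    and Z: "\<And>s. 0 \<le> s \<Longrightarrow> s < T \<Longrightarrow> Z s \<omega> = right_lim v s \<omega>"
  shows "((\<lambda>s. Z s \<omega>) \<longlongrightarrow> left_lim v t \<omega>) (at_left t)"
proof (rule Lim_transform_eventually)
  show "((\<lambda>s. right_lim v s \<omega>) \<longlongrightarrow> left_lim v t \<omega>) (at_left t)"
    unfolding right_lim_def using right_lim_tendsto[OF v \<omega>]
    by (intro right_limits_tendsto_left left_lim_tendsto[OF v \<omega> t(1)] t(1)) blast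
  show "eventually (\<lambda>s. right_lim v s \<omega> = Z s \<omega>) (at_left t)"
    using t by (intro eventually_at_leftI[of 0]) (auto simp: Z)
qed

lemma cadlag_right_lim_stopped:
  assumes v: "laglad P v"
    and Z: "\<And>t \<omega>. \<omega> \<in> space P \<Longrightarrow> 0 \<le> t \<Longrightarrow> Z t \<omega> = (if t < \<tau> \<omega> then right_lim v t \<omega> else \<xi> \<omega>)"
  shows "cadlag P Z"
  unfolding cadlag_def
proof (intro ballI allI impI conjI)
  fix \<omega> and t :: real assume \<omega>: "\<omega> \<in> space P" and t: "0 \<le> t"
  show "((\<lambda>s. Z s \<omega>) \<longlongrightarrow> Z t \<omega>) (at_right t)"
  proof (cases "t < \<tau> \<omega>")
    case True
    have "((\<lambda>s. right_lim v s \<omega>) \<longlongrightarrow> right_lim v t \<omega>) (at_right t)"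
      using right_limits_tendsto_right[of "\<lambda>s. v s \<omega>", OF _ t right_lim_tendsto[OF v \<omega> t]]
        right_lim_tendsto[OF v \<omega>]
      by (auto simp: right_lim_def)
    moreover have "eventually (\<lambda>s. right_lim v s \<omega> = Z s \<omega>) (at_right t)"
      using True t by (intro eventually_at_rightI[of t "\<tau> \<omega>"]) (auto simp: Z[OF \<omega>])
    ultimately show ?thesis
      using True t by (auto simp: Z[OF \<omega>] intro: Lim_transform_eventually)
  next
    case False
    have "eventually (\<lambda>s. Z t \<omega> = Z s \<omega>) (at_right t)"
      using False t by (intro eventually_at_rightI[of t "t + 1"]) (auto simp: Z[OF \<omega>])
    then show ?thesis by (rule Lim_transform_eventually[OF tendsto_const])
  qed
  assume "0 < t"
  show "\<exists>l. ((\<lambda>s. Z s \<omega>) \<longlongrightarrow> l) (at_left t)"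
  proof (cases "t \<le> \<tau> \<omega>")
    case True
    show ?thesis
      using tendsto_left_right_lim_stopped[OF v \<omega> \<open>0 < t\<close> True, of Z] Z[OF \<omega>] by auto
  next
    case False
    have "eventually (\<lambda>s. Z t \<omega> = Z s \<omega>) (at_left t)"
      using False \<open>0 < t\<close> by (intro eventually_at_leftI[of "max 0 (\<tau> \<omega>)"]) (auto simp: Z[OF \<omega>])
    then show ?thesis by (intro exI) (rule Lim_transform_eventually[OF tendsto_const])
  qed
qed

lemma infsum_finite_support:
  fixes H :: "'a \<Rightarrow> real"
  assumes "finite J" "\<And>s. s \<in> A - J \<Longrightarrow> H s = 0"
  shows "infsum H A = sum H (J \<inter> A)"
  using assms infsum_cong_neutral[of "J \<inter> A" A H H] by auto

text \<open>For \<open>u\<close> close to \<open>t\<close> no point of \<open>J\<close> lies in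
  \<open>(t, u]\<close>, so the sum is eventually constant. The term at \<open>t\<close> is lost in
  the limit, which turns the range \<open>t \<le> s\<close> into \<open>t < s\<close>.\<close>

lemma infsum_tendsto_right:
  fixes H :: "real \<Rightarrow> real"
  assumes J: "finite J" and H: "\<And>s. t \<le> s \<Longrightarrow> s < b \<Longrightarrow> s \<notin> J \<Longrightarrow> H s = 0" and t: "t < b"
  shows "((\<lambda>u. infsum H {u..<b}) \<longlongrightarrow> infsum H {t<..<b}) (at_right t)"
proof (rule Lim_transform_eventually[OF tendsto_const])
  have "eventually (\<lambda>u. \<forall>s\<in>J. t < s \<longrightarrow> u < s) (at_right t)"
  proof (intro eventually_ball_finite J ballI)
    fix s show "eventually (\<lambda>u. t < s \<longrightarrow> u < s) (at_right t)"
      by (cases "t < s") (auto intro: eventually_at_rightI[of t s])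
  qed
  moreover have "eventually (\<lambda>u. t < u) (at_right t)" by (rule eventually_at_right_less)
  ultimately show "eventually (\<lambda>u. infsum H {t<..<b} = infsum H {u..<b}) (at_right t)"
  proof eventually_elim
    case (elim u)
    then have "J \<inter> {t<..<b} = J \<inter> {u..<b}" by force
    then show ?case
      using H elim by (subst (1 2) infsum_finite_support[OF J]) auto
  qed
qed

text \<open>Integrability makes the choice by \<open>SOME\<close> a genuine version, which is a
  cadlag local martingale by definition.\<close>

lemma cadlag_stoch_integral:
  assumes "stoch_integrable P F z M"
  shows "cadlag P (stoch_integral P F z M)"
proof -
  have "has_stoch_integral P F z M (stoch_integral P F z M)"
    using assms unfolding stoch_integrable_def stoch_integral_def by (rule someI_ex)
  then show ?thesis by (simp add: has_stoch_integral_def local_martingale_def)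
qed

theorem proposition13p1:
  fixes P :: "'a measure" and F :: "real \<Rightarrow> 'a measure"
    and \<tau> \<xi> :: "'a \<Rightarrow> real"
    and f :: "real \<Rightarrow> 'a \<Rightarrow> real \<Rightarrow> real \<Rightarrow> real^'d \<Rightarrow> real"
    and h :: "real \<Rightarrow> 'a \<Rightarrow> real \<Rightarrow> real \<Rightarrow> real"
    and Dr Dc v y :: "real \<Rightarrow> 'a \<Rightarrow> real"
    and M z :: "real \<Rightarrow> 'a \<Rightarrow> real^'d"
    and p :: nat and T :: "nat \<Rightarrow> 'a \<Rightarrow> ereal"
  assumes usual: "usual_conditions P F"
    and M: "local_martingale_vec P F M"
    and Dr: "adapted F Dr" "cadlag P Dr" "finite_variation P Dr"
    and Dc: "Dc = continuous_part Dr"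
    and \<tau>: "finite_stopping_time P F \<tau>"
    and \<xi>: "\<xi> \<in> borel_measurable (filtration.pre_sigma (space P) F \<tau>)"
      "\<exists>b. \<forall>\<omega>\<in>space P. \<bar>\<xi> \<omega>\<bar> \<le> b"
    and T: "\<And>i. i \<in> {1..p} \<Longrightarrow> predictable_stopping_time P F (T i)"
    and h: "\<And>s \<omega> a b. 0 \<le> s \<Longrightarrow> \<omega> \<in> space P \<Longrightarrow> \<forall>i\<in>{1..p}. T i \<omega> \<noteq> ereal s \<Longrightarrow> h s \<omega> a b = 0"
    and v: "laglad_bsde_solution P F \<tau> \<xi> f h Dc M v z"
    and y: "y = (\<lambda>t \<omega>. right_lim v t \<omega> * indicator {0..\<tau> \<omega>} t
                   + h (\<tau> \<omega>) \<omega> (left_lim v (\<tau> \<omega>) \<omega>) (\<xi> \<omega>) * indicator {\<tau> \<omega>} t)"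
  shows "cadlag_bsde_solution P F \<tau> \<xi> f h Dc M (stopped \<tau> y) z"
proof -
  \<comment> \<open>After \<tau> both indicators in \<open>y\<close> vanish; stopping replaces the
    value 0 there by the value at \<tau>.\<close>
  define Z where "Z = stopped \<tau> y"
  define Y where "Y \<omega> = v (\<tau> \<omega>) \<omega> + h (\<tau> \<omega>) \<omega> (left_lim v (\<tau> \<omega>) \<omega>) (\<xi> \<omega>)" for \<omega>
  define N where "N = stoch_integral P F (restrict_to \<tau> z) M"
  define H where "H \<omega> s = h s \<omega> (left_lim v s \<omega>) (right_lim v s \<omega>)" for \<omega> s
  define \<phi> where "\<phi> \<omega> s = f s \<omega> (left_lim v s \<omega>) (v s \<omega>) (z s \<omega>)" for \<omega> s
  \<comment> \<open>The times that \<open>h\<close> can charge on the path of \<omega>; a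
    \<open>T i\<close> with value \<infinity> contributes none.\<close>
  define C where "C \<omega> = {s. \<exists>i\<in>{1..p}. T i \<omega> = ereal s}" for \<omega>
  have lag: "laglad P v" and opt: "optional_process P F v" and pred: "predictable_process P F z"
    and stop: "stopped_at P \<tau> v" and si: "stoch_integrable P F (restrict_to \<tau> z) M"
    and v_eq: "AE \<omega> in P. ls_integrable (\<phi> \<omega>) (\<lambda>s. Dc s \<omega>) {0<..\<tau> \<omega>} \<and>
        (\<forall>t\<in>{0..\<tau> \<omega>}.
           v t \<omega> = \<xi> \<omega> - h (\<tau> \<omega>) \<omega> (left_lim v (\<tau> \<omega>) \<omega>) (\<xi> \<omega>)
             - ls_integral (\<phi> \<omega>) (\<lambda>s. Dc s \<omega>) {t<..\<tau> \<omega>}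
             - (N (\<tau> \<omega>) \<omega> - N t \<omega>) - infsum (H \<omega>) {t..<\<tau> \<omega>})"
    using v unfolding laglad_bsde_solution_def stoch_integral_upto_def N_def H_def \<phi>_def by auto
  have \<tau>0: "0 \<le> \<tau> \<omega>" if "\<omega> \<in> space P" for \<omega>
    using \<tau> that by (simp add: finite_stopping_time_def)
  have finC: "finite (C \<omega>)" for \<omega>
    by (rule finite_subset[of _ "(\<lambda>i. real_of_ereal (T i \<omega>)) ` {1..p}"]) (force simp: C_def)+
  have hC: "h s \<omega> a b = 0" if "0 \<le> s" "\<omega> \<in> space P" "s \<notin> C \<omega>" for s \<omega> a b
    using h that by (auto simp: C_def)
  have v_\<tau>: "right_lim v (\<tau> \<omega>) \<omega> = v (\<tau> \<omega>) \<omega>" if \<omega>: "\<omega> \<in> space P" for \<omega>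
  proof -
    have "eventually (\<lambda>s. v (\<tau> \<omega>) \<omega> = v s \<omega>) (at_right (\<tau> \<omega>))"
    proof (rule eventually_at_rightI[of _ "\<tau> \<omega> + 1"])
      fix s assume "s \<in> {\<tau> \<omega><..<\<tau> \<omega> + 1}"
      then have "0 \<le> s" "min s (\<tau> \<omega>) = \<tau> \<omega>" using \<tau>0[OF \<omega>] by auto
      then show "v (\<tau> \<omega>) \<omega> = v s \<omega>" using stop \<omega> by (metis stopped_at_def stopped_def)
    qed simp
    then have "((\<lambda>s. v s \<omega>) \<longlongrightarrow> v (\<tau> \<omega>) \<omega>) (at_right (\<tau> \<omega>))"
      by (rule Lim_transform_eventually[OF tendsto_const])
    then show ?thesis
      using right_lim_tendsto[OF lag \<omega> \<tau>0[OF \<omega>]] tendsto_unique trivial_limit_at_right_real by blast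
  qed
  have Z: "Z t \<omega> = (if t < \<tau> \<omega> then right_lim v t \<omega> else Y \<omega>)" if "\<omega> \<in> space P" "0 \<le> t" for t \<omega>
    using that \<tau>0[OF that(1)] v_\<tau>[OF that(1)] by (auto simp: Z_def stopped_def y Y_def min_def)
  have cad: "cadlag P Z" by (rule cadlag_right_lim_stopped[OF lag Z])
  have Zleft: "left_lim Z t \<omega> = left_lim v t \<omega>" if "\<omega> \<in> space P" "0 < t" "t \<le> \<tau> \<omega>" for t \<omega>
    using tendsto_Lim[OF _ tendsto_left_right_lim_stopped[OF lag that, of Z]] Z[OF that(1)] that
    by (simp add: left_lim_def[of Z])
  \<comment> \<open>At \<open>t = \<tau>\<close> both integrals and the sum in the equation for
    \<open>v\<close> vanish, leaving \<open>v\<close> plus the \<open>h\<close> term equal to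
    \<xi>.\<close>
  have Y: "AE \<omega> in P. Y \<omega> = \<xi> \<omega>"
    using v_eq AE_space
  proof eventually_elim
    case (elim \<omega>)
    then show ?case
      using \<tau>0[of \<omega>] ls_integral_empty[of "\<phi> \<omega>" "\<lambda>s. Dc s \<omega>" "\<tau> \<omega>"] by (simp add: Y_def)
  qed
  have "adapted F (\<lambda>t \<omega>. if t < \<tau> \<omega> then right_lim v t \<omega> else \<xi> \<omega>)"
    by (intro adapted_glue_at_stopping_time[OF usual \<tau> _ \<xi>(1)]
      adapted_right_lim[OF usual adapted_optional_process[OF usual opt] lag])
  \<comment> \<open>The process with \<xi> in place of \<open>Y\<close> is adapted by gluing;
    \<open>Z t\<close> is a null modification of it.\<close>
  then have "adapted F Z"
    unfolding adapted_def
  proof safe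
    fix t :: real assume t: "0 \<le> t"
      and "\<forall>t\<ge>0. (\<lambda>\<omega>. if t < \<tau> \<omega> then right_lim v t \<omega> else \<xi> \<omega>) \<in> borel_measurable (F t)"
    then have W: "(\<lambda>\<omega>. if t < \<tau> \<omega> then right_lim v t \<omega> else \<xi> \<omega>) \<in> borel_measurable (F t)" by blast
    have "AE \<omega> in P. Z t \<omega> = (if t < \<tau> \<omega> then right_lim v t \<omega> else \<xi> \<omega>)"
      using Y AE_space by eventually_elim (simp add: Z t)
    then show "Z t \<in> borel_measurable (F t)" by (rule borel_measurable_AE_eq[OF usual t W])
  qed
  then have optZ: "optional_process P F Z" by (rule optional_process_cadlag[OF _ cad])
  have "AE \<omega> in P.
        ls_integrable (\<lambda>s. f s \<omega> (left_lim Z s \<omega>) (Z s \<omega>) (z s \<omega>)) (\<lambda>s. Dc s \<omega>) {0<..\<tau> \<omega>} \<and>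
        (\<forall>t\<in>{0..\<tau> \<omega>}.
           Z t \<omega> = \<xi> \<omega>
             - ls_integral (\<lambda>s. f s \<omega> (left_lim Z s \<omega>) (Z s \<omega>) (z s \<omega>)) (\<lambda>s. Dc s \<omega>) {t<..\<tau> \<omega>}
             - (\<Sum>\<^sub>\<infinity>s\<in>{t<..\<tau> \<omega>}. h s \<omega> (left_lim Z s \<omega>) (Z s \<omega>))
             - (N (\<tau> \<omega>) \<omega> - N t \<omega>))"
    using v_eq Y AE_space
  proof eventually_elim
    case (elim \<omega>)
    define b where "b = \<tau> \<omega>"
    define h\<^sub>\<tau> where "h\<^sub>\<tau> = h b \<omega> (left_lim v b \<omega>) (\<xi> \<omega>)"
    define I where "I t = ls_integral (\<phi> \<omega>) (\<lambda>s. Dc s \<omega>) {t<..b}" for t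
    define \<psi> where "\<psi> s = f s \<omega> (left_lim Z s \<omega>) (Z s \<omega>) (z s \<omega>)" for s
    define K where "K s = h s \<omega> (left_lim Z s \<omega>) (Z s \<omega>)" for s
    have \<omega>: "\<omega> \<in> space P" and b: "0 \<le> b" and Z\<tau>: "Z b \<omega> = \<xi> \<omega>"
      using elim \<tau>0[of \<omega>] Z[of \<omega> b] by (auto simp: b_def)
    have int: "ls_integrable (\<phi> \<omega>) (\<lambda>s. Dc s \<omega>) {0<..b}" using elim by (simp add: b_def)
    have v_t: "v t \<omega> = \<xi> \<omega> - h\<^sub>\<tau> - I t - (N b \<omega> - N t \<omega>) - infsum (H \<omega>) {t..<b}"
      if "0 \<le> t" "t \<le> b" for t
      using elim that by (simp add: b_def h\<^sub>\<tau>_def I_def)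
    have H0: "H \<omega> s = 0" if "0 \<le> s" "s \<notin> C \<omega>" for s
      using hC[OF that(1) \<omega> that(2)] by (simp add: H_def)
    \<comment> \<open>The equation for \<open>v\<close> at \<open>u\<close> in \<open>(t, b)\<close>
      is passed to the limit term by term, with cadlag paths of \<open>N\<close> for the stochastic
      part.\<close>
    have v_right: "right_lim v t \<omega> =
        \<xi> \<omega> - h\<^sub>\<tau> - I t - (N b \<omega> - N t \<omega>) - infsum (H \<omega>) {t<..<b}" if t: "0 \<le> t" "t < b" for t
    proof (rule tendsto_unique[OF trivial_limit_at_right_real right_lim_tendsto[OF lag \<omega> t(1)]])
      have "((\<lambda>u. \<xi> \<omega> - h\<^sub>\<tau> - I u - (N b \<omega> - N u \<omega>) - infsum (H \<omega>) {u..<b}) \<longlongrightarrow>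
        \<xi> \<omega> - h\<^sub>\<tau> - I t - (N b \<omega> - N t \<omega>) - infsum (H \<omega>) {t<..<b}) (at_right t)"
        using cadlag_stoch_integral[OF si, folded N_def] \<omega> t H0 unfolding I_def
        by (intro tendsto_diff tendsto_const ls_integral_tendsto_right[OF int t]
          infsum_tendsto_right[OF finC[of \<omega>]]) (auto simp: cadlag_def)
      moreover have "eventually (\<lambda>u. \<xi> \<omega> - h\<^sub>\<tau> - I u - (N b \<omega> - N u \<omega>) - infsum (H \<omega>) {u..<b} = v u \<omega>) (at_right t)"
        using t by (intro eventually_at_rightI[of t b]) (auto simp: v_t)
      ultimately show "((\<lambda>u. v u \<omega>) \<longlongrightarrow>
        \<xi> \<omega> - h\<^sub>\<tau> - I t - (N b \<omega> - N t \<omega>) - infsum (H \<omega>) {t<..<b}) (at_right t)"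
        by (rule Lim_transform_eventually)
    qed
    \<comment> \<open>Off \<open>C \<omega>\<close> the term of the sum at \<open>s\<close> is 0, so
      the equations for \<open>v\<close> and for its right limit coincide.\<close>
    have Z_v: "Z s \<omega> = v s \<omega>" if "0 < s" "s < b" "s \<notin> C \<omega>" for s
    proof -
      have "infsum (H \<omega>) {s..<b} = infsum (H \<omega>) {s<..<b}"
        using H0 that by (intro infsum_cong_neutral) (auto simp: order_less_le)
      then show ?thesis using v_t[of s] v_right[of s] Z[OF \<omega>, of s] that by (simp add: b_def)
    qed
    \<comment> \<open>The end point \<open>b\<close> joins the exceptional set because there
      \<open>Z\<close> equals \<xi>, which may differ from \<open>v\<close> by the \<open>h\<close>
      term.\<close>
    have \<psi>: "\<psi> s = \<phi> \<omega> s" if "s \<in> {0<..b} - insert b (C \<omega>)" for s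
      using that Z_v[of s] Zleft[OF \<omega>, of s] by (auto simp: \<psi>_def \<phi>_def b_def)
    have cont: "((\<lambda>s. Dc s \<omega>) \<longlongrightarrow> Dc s \<omega>) (at_left s)" if "0 < s" for s
      unfolding Dc by (rule continuous_part_left_continuous[OF Dr(2,3) \<omega> that])
    have int': "ls_integrable \<psi> (\<lambda>s. Dc s \<omega>) {0<..b}"
      using int \<psi> cont finC[of \<omega>]
      by (subst ls_integral_cong_finite(2)[where C="insert b (C \<omega>)" and f="\<phi> \<omega>"]) auto
    have I': "ls_integral \<psi> (\<lambda>s. Dc s \<omega>) {t<..b} = I t" if "0 \<le> t" for t
      unfolding I_def using \<psi> cont finC[of \<omega>] that
      by (intro ls_integral_cong_finite(1)[where C="insert b (C \<omega>)"]) auto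
    have "Z t \<omega> = \<xi> \<omega> - ls_integral \<psi> (\<lambda>s. Dc s \<omega>) {t<..b} - infsum K {t<..b} - (N b \<omega> - N t \<omega>)"
      if t: "0 \<le> t" "t \<le> b" for t
    proof (cases "t = b")
      case True
      then show ?thesis using I'[OF b] ls_integral_empty[OF int b] Z\<tau> by (simp add: I_def)
    next
      case False
      then have t': "t < b" using t by simp
      \<comment> \<open>The new sum includes \<open>b\<close>: its term there is the constant
        \<open>h\<^sub>\<tau>\<close> subtracted in the equation for \<open>v\<close>, and its
        earlier terms are those of \<open>H\<close>.\<close>
      have "infsum K {t<..b} = sum K (insert b (C \<omega>) \<inter> {t<..b})"
        using finC[of \<omega>] hC[OF _ \<omega>] t by (intro infsum_finite_support) (auto simp: K_def)
      also have "insert b (C \<omega>) \<inter> {t<..b} = insert b (C \<omega> \<inter> {t<..<b})" using t' by auto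
      also have "sum K \<dots> = K b + sum K (C \<omega> \<inter> {t<..<b})"
        using finC[of \<omega>] by simp
      also have "sum K (C \<omega> \<inter> {t<..<b}) = sum (H \<omega>) (C \<omega> \<inter> {t<..<b})"
        using t Z[OF \<omega>] Zleft[OF \<omega>] by (intro sum.cong) (auto simp: K_def H_def b_def)
      also have "\<dots> = infsum (H \<omega>) {t<..<b}"
        using H0 t by (intro infsum_finite_support[symmetric] finC) auto
      also have "K b = h\<^sub>\<tau>"
        using Zleft[OF \<omega>, of b] Z\<tau> t t' by (simp add: K_def h\<^sub>\<tau>_def b_def)
      finally show ?thesis
        using v_right[OF t(1) t'] Z[OF \<omega> t(1)] t' I'[OF t(1)] by (simp add: b_def)
    qed
    then show ?case
      using int' unfolding b_def \<psi>_def K_def by auto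
  qed
  then show ?thesis
    using optZ pred cad si unfolding cadlag_bsde_solution_def stoch_integral_upto_def N_def Z_def
    by (auto simp: stopped_at_def stopped_def)
qed

end
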